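(* Let $K, L \subseteq \mathbb{R}^n$ be convex bodies with $L$ origin-symmetric. If $$\frac{D(K,L)}{r(K,L)} = \min_{\det(A) \neq 0} \frac{D(AK,L)}{r(AK,L)}, \qquad ( * )$$ where the minimum is over all invertible matrices $A \in \mathbb{R}^{n \times n}$, then for any vector $c \in \mathbb{R}^n$ with $r(K,L) L + c \subseteq K$, there exist integers $N, M \geq 1$, contact pairs $(x^1,a^1), \ldots, (x^N,a^N)$ of $K$ and $r(K,L) L + c$, diameter triples $(y^1,z^1,b^1), \ldots, (y^M,z^M,b^M)$ of $K$ with respect to $L$, as well as weights $\lambda_1, \ldots, \lambda_N, \mu_1, \ldots, \mu_M > 0$ such that for any $x \in \mathbb{R}^n$, $$\sum_{i=1}^N \lambda_i \langle x, a^i \rangle x^i = \sum_{j=1}^M \mu_j \langle x, b^j \rangle (y^j - z^j) \quad \text{and} \quad \sum_{i=1}^N \lambda_i a^i = \sum_{j=1}^M \mu_j b^j = 0.$$ If $L$ is an ellipsoid, then the converse is also true, in the sense that if for every $c \in \mathbb{R}^n$ with $r(K,L) L + c \subseteq K$ there exist integers $N, M \geq 1$, contact pairs of $K$ and $r(K,L) L + c$, diameter triples of $K$ with respect to $L$, and positive weights satisfying the two displayed identities (the first for all $x \in \mathbb{R}^n$), then $( * )$ holds.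
   Context: A convex body in $\mathbb{R}^n$ is a compact convex set with non-empty interior; it is origin-symmetric if $-L = L$. $\langle \cdot, \cdot \rangle$ is the standard inner product and $\operatorname{bd}$ denotes boundary. For a convex body $L$ with $0$ in its interior, $\|x\|_L = \min \{ \rho \geq 0 : x \in \rho L \}$ is its gauge function and $L^\circ = \{ a \in \mathbb{R}^n : \langle x, a \rangle \leq 1 \text{ for all } x \in L \}$ its polar. For convex bodies $K, L \subseteq \mathbb{R}^n$ with $L$ origin-symmetric, the diameter of $K$ with respect to $L$ is $D(K,L) = \max \{ \|x - y\|_L : x, y \in K \}$ and the inradius is $r(K,L) = \max \{ \rho \geq 0 : \rho L + c \subseteq K, \ c \in \mathbb{R}^n \}$. A triple $(y,z,b)$ is a diameter triple of $K$ with respect to $L$ if $y, z \in K$, $b \in L^\circ$, and $\langle y - z, b \rangle = \|y - z\|_L = D(K,L)$. For two convex bodies $C \subseteq D$, a contact pair $(y,a)$ of the two bodies consists of a point $y \in \operatorname{bd}(C) \cap \operatorname{bd}(D)$ and a non-zero $a \in \mathbb{R}^n$ such that $\langle a, y \rangle \geq \langle a, x \rangle$ for every $x \in D$. Thus for contact pairs of $K$ and $r(K,L) L + c \subseteq K$ the larger body is $D = K$. *)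

theory Defs
  imports "HOL-Analysis.Analysis"
begin

definition convex_body :: "'a::euclidean_space set \<Rightarrow> bool" where
  "convex_body K \<longleftrightarrow> compact K \<and> convex K \<and> interior K \<noteq> {}"

definition origin_symmetric :: "'a::real_vector set \<Rightarrow> bool" where
  "origin_symmetric L \<longleftrightarrow> uminus ` L = L"

definition homothet :: "real \<Rightarrow> 'a \<Rightarrow> 'a set \<Rightarrow> 'a::real_vector set" where
  "homothet \<rho> c L = (\<lambda>x. \<rho> *\<^sub>R x + c) ` L"

text \<open>The minima and maxima below are written with \<open>LEAST\<close> and \<open>GREATEST\<close>. They are attained
  whenever the sets are convex bodies and, where \<open>L\<close> serves as a gauge body, \<open>0\<close> is interior
  to \<open>L\<close>; an origin-symmetric convex body always has \<open>0\<close> in its interior.\<close>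

definition gauge_fun :: "'a set \<Rightarrow> 'a::real_vector \<Rightarrow> real" where
  "gauge_fun L x = (LEAST \<rho>. 0 \<le> \<rho> \<and> x \<in> homothet \<rho> 0 L)"

definition polar :: "'a::real_inner set \<Rightarrow> 'a set" where
  "polar L = {a. \<forall>x\<in>L. x \<bullet> a \<le> 1}"

definition rel_diameter :: "'a set \<Rightarrow> 'a::real_vector set \<Rightarrow> real" where
  "rel_diameter K L = (GREATEST d. \<exists>x\<in>K. \<exists>y\<in>K. d = gauge_fun L (x - y))"

definition rel_inradius :: "'a set \<Rightarrow> 'a::real_vector set \<Rightarrow> real" where
  "rel_inradius K L = (GREATEST \<rho>. 0 \<le> \<rho> \<and> (\<exists>c. homothet \<rho> c L \<subseteq> K))"

definition diameter_triple :: "'a set \<Rightarrow> 'a set \<Rightarrow> 'a \<Rightarrow> 'a \<Rightarrow> 'a::real_inner \<Rightarrow> bool" where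
  "diameter_triple K L y z b \<longleftrightarrow> y \<in> K \<and> z \<in> K \<and> b \<in> polar L \<and>
     (y - z) \<bullet> b = gauge_fun L (y - z) \<and> gauge_fun L (y - z) = rel_diameter K L"

text \<open>The outer normal \<open>a\<close> supports the larger body, which is the second argument.\<close>

definition contact_pair :: "'a set \<Rightarrow> 'a set \<Rightarrow> 'a \<Rightarrow> 'a::real_inner \<Rightarrow> bool" where
  "contact_pair C D y a \<longleftrightarrow>
     y \<in> frontier C \<inter> frontier D \<and> a \<noteq> 0 \<and> (\<forall>x\<in>D. a \<bullet> x \<le> a \<bullet> y)"

definition ellipsoid :: "(real^'n) set \<Rightarrow> bool" where
  "ellipsoid L \<longleftrightarrow>
     (\<exists>(T :: real^'n^'n) c. det T \<noteq> 0 \<and> L = (\<lambda>x. T *v x + c) ` cball 0 1)"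

definition is_minimum :: "'a::order \<Rightarrow> 'a set \<Rightarrow> bool" where
  "is_minimum m S \<longleftrightarrow> m \<in> S \<and> (\<forall>s\<in>S. m \<le> s)"

definition min_diameter_inradius_ratio :: "(real^'n) set \<Rightarrow> (real^'n) set \<Rightarrow> bool" where
  "min_diameter_inradius_ratio K L \<longleftrightarrow>
     is_minimum (rel_diameter K L / rel_inradius K L)
       {rel_diameter ((*v) A ` K) L / rel_inradius ((*v) A ` K) L | A :: real^'n^'n. det A \<noteq> 0}"

definition contact_diameter_decomposition ::
    "'a set \<Rightarrow> 'a set \<Rightarrow> 'a::real_inner \<Rightarrow> bool" where
  "contact_diameter_decomposition K L c \<longleftrightarrow>
     (\<exists>(N::nat) (M::nat) (x :: nat \<Rightarrow> 'a) (a :: nat \<Rightarrow> 'a)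
        (y :: nat \<Rightarrow> 'a) (z :: nat \<Rightarrow> 'a) (b :: nat \<Rightarrow> 'a)
        (lam :: nat \<Rightarrow> real) (\<mu> :: nat \<Rightarrow> real).
        1 \<le> N \<and> 1 \<le> M \<and>
        (\<forall>i\<in>{1..N}. contact_pair (homothet (rel_inradius K L) c L) K (x i) (a i)) \<and>
        (\<forall>j\<in>{1..M}. diameter_triple K L (y j) (z j) (b j)) \<and>
        (\<forall>i\<in>{1..N}. 0 < lam i) \<and> (\<forall>j\<in>{1..M}. 0 < \<mu> j) \<and>
        (\<forall>v. (\<Sum>i=1..N. (lam i * (v \<bullet> a i)) *\<^sub>R x i)
              = (\<Sum>j=1..M. (\<mu> j * (v \<bullet> b j)) *\<^sub>R (y j - z j))) \<and>
        (\<Sum>i=1..N. lam i *\<^sub>R a i) = 0 \<and> (\<Sum>j=1..M. \<mu> j *\<^sub>R b j) = 0)"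

end

theory Submission
  imports Defs
begin

text \<open>
  Necessity is a Lagrange multiplier argument, carried out by separation of convex sets. Encode a
  contact pair \<open>(x, a)\<close> as \<open>(a \<otimes> x, a, 0)\<close> and a diameter triple \<open>(y, z, b)\<close> as
  \<open>(- b \<otimes> (y - z), 0, b)\<close>. A nontrivial nonnegative combination of these vectors that vanishes is
  what is asked for. Its trace, with \<open>K\<close> recentred at \<open>c\<close>, shows that both kinds of vectors occur: a
  contact pair contributes \<open>a \<bullet> (x - c) > 0\<close>, a diameter triple contributes \<open>- D(K, L) < 0\<close>. If there is no such
  combination, then \<open>0\<close> is outside a compact convex hull, and a separating functional \<open>(A, u, v)\<close> is
  a first-order improvement (\<open>decomposition_or_improving_direction\<close>): \<open>a \<bullet> (A x + u) > 0\<close> says that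
  \<open>x \<mapsto> x + t (A x + u)\<close> pushes the boundary of \<open>K\<close> outwards at every contact point, so the inscribed
  copy of \<open>L\<close> stays inside (\<open>perturbation_keeps_subset\<close>), while \<open>b \<bullet> A (y - z) < 0\<close> says that every
  diameter shrinks (\<open>rel_diameter_decreases\<close>). For small \<open>t > 0\<close> the matrix \<open>1 + t A\<close> is invertible
  and gives a smaller ratio, contradicting minimality.

  For sufficiency, let \<open>L\<close> be the image of the unit ball under \<open>T\<close>, and pass to coordinates in which
  \<open>L\<close> is the unit ball. Then contact points, taken relative to \<open>c\<close>, and their normals become multiples of
  the same unit vectors \<open>u\<^sub>i\<close>, the diameter triples become multiples of unit vectors \<open>\<beta>\<^sub>j\<close>, and the decomposition says
  \<open>r \<Sum> w\<^sub>i u\<^sub>i \<otimes> u\<^sub>i = D \<Sum> \<mu>\<^sub>j \<beta>\<^sub>j \<otimes> \<beta>\<^sub>j\<close>. A matrix \<open>A\<close> acts in these coordinates as some \<open>S\<close>. Since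
  \<open>D |S \<beta>\<^sub>j| \<le> D'\<close> for the new diameter \<open>D'\<close>, taking traces bounds the weighted mean of
  \<open>|S u\<^sub>i|\<^sup>2\<close> by \<open>(D' / D)\<^sup>2\<close>. The hyperplanes that support \<open>K\<close> at the contact points
  show that the new inradius \<open>r'\<close> satisfies \<open>r' \<Sum> w\<^sub>i / |S u\<^sub>i| \<le> r \<Sum> w\<^sub>i\<close>. Jensen's inequality for
  \<open>1 / sqrt x\<close> combines the two bounds to \<open>D / r \<le> D' / r'\<close> (\<open>decomposition_imp_ratio_le\<close>).
\<close>

section \<open>Gauge, diameter and inradius are attained\<close>

lemma symmetric_convex_body_0_interior:
  assumes "convex_body L" and "origin_symmetric L"
  shows "0 \<in> interior L"
proof -
  obtain p where p: "p \<in> interior L"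
    using assms(1) by (auto simp: convex_body_def)
  have "uminus ` interior L = interior L"
    using assms(2) interior_negations[of L] by (simp add: origin_symmetric_def)
  then have "- p \<in> interior L"
    using p by blast
  moreover have "convex (interior L)"
    using assms(1) by (simp add: convex_body_def convex_interior)
  ultimately have "(1/2) *\<^sub>R p + (1/2) *\<^sub>R (- p) \<in> interior L"
    using p by (intro convexD) auto
  then show ?thesis by simp
qed

lemma polar_uminus:
  assumes "origin_symmetric L" and "b \<in> polar L"
  shows "- b \<in> polar L"
proof -
  have "- x \<in> L" if "x \<in> L" for x
    using assms(1) that by (auto simp: origin_symmetric_def)
  then show ?thesis
    using assms(2) by (force simp: polar_def)
qed

lemma polar_contains_cball:
  fixes L :: "'a::euclidean_space set"
  assumes "bounded L"
  obtains e where "e > 0" and "cball 0 e \<subseteq> polar L"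
proof -
  obtain M where M: "M > 0" "\<And>x. x \<in> L \<Longrightarrow> norm x \<le> M"
    using assms by (auto simp: bounded_pos)
  have "a \<in> polar L" if "norm a \<le> 1 / M" for a
    unfolding polar_def
  proof safe
    fix x assume "x \<in> L"
    then have "norm x * norm a \<le> M * (1 / M)"
      using M that by (intro mult_mono) auto
    then show "x \<bullet> a \<le> 1"
      using norm_cauchy_schwarz[of x a] M(1) by simp
  qed
  then have "cball 0 (1 / M) \<subseteq> polar L" by auto
  then show ?thesis
    using that[of "1 / M"] M(1) by simp
qed

lemma compact_polar:
  fixes L :: "'a::euclidean_space set"
  assumes "0 \<in> interior L"
  shows "compact (polar L)"
proof -
  obtain e where e: "e > 0" "cball 0 e \<subseteq> L"
    using assms by (auto simp: mem_interior_cball)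
  have "norm b \<le> 1 / e" if "b \<in> polar L" for b
  proof (cases "b = 0")
    case False
    have "(e / norm b) *\<^sub>R b \<in> L"
      using e False by (intro subsetD[OF e(2)]) (auto simp: dist_norm)
    then have "(e / norm b) *\<^sub>R b \<bullet> b \<le> 1"
      using that by (auto simp: polar_def)
    then have "e * norm b \<le> 1"
      using False by (simp add: power2_norm_eq_inner[symmetric] power2_eq_square)
    then show ?thesis
      using e by (simp add: field_simps)
  qed (use e in auto)
  then have "bounded (polar L)"
    by (auto simp: bounded_iff)
  moreover have "polar L = (\<Inter>x\<in>L. {a. x \<bullet> a \<le> 1})"
    by (auto simp: polar_def)
  then have "closed (polar L)"
    by (auto intro!: closed_halfspace_le)
  ultimately show ?thesis
    by (simp add: compact_eq_bounded_closed)
qed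

text \<open>This is the bipolar theorem, scaled by \<open>\<rho>\<close>: a point outside \<open>\<rho> L\<close> is cut off by a
  hyperplane, whose normal can be normalised to lie in the polar because \<open>0\<close> is interior to \<open>L\<close>.
  For \<open>\<rho> = 0\<close> the right-hand side forces \<open>x = 0\<close>, because the polar is a neighbourhood of \<open>0\<close>.\<close>

lemma mem_scaled_iff_polar:
  fixes L :: "'a::euclidean_space set"
  assumes "compact L" "convex L" "0 \<in> interior L" and "0 \<le> \<rho>"
  shows "x \<in> homothet \<rho> 0 L \<longleftrightarrow> (\<forall>b\<in>polar L. x \<bullet> b \<le> \<rho>)"
proof
  assume "x \<in> homothet \<rho> 0 L"
  then obtain w where "w \<in> L" "x = \<rho> *\<^sub>R w"
    by (auto simp: homothet_def)
  then show "\<forall>b\<in>polar L. x \<bullet> b \<le> \<rho>"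
    using assms(4) by (auto simp: polar_def mult_left_le)
next
  assume R: "\<forall>b\<in>polar L. x \<bullet> b \<le> \<rho>"
  have "0 \<in> L" using assms(3) interior_subset by blast
  show "x \<in> homothet \<rho> 0 L"
  proof (cases "\<rho> = 0")
    case True
    obtain e where e: "e > 0" "cball 0 e \<subseteq> polar L"
      using polar_contains_cball compact_imp_bounded assms(1) by blast
    have "x = 0"
    proof (rule ccontr)
      assume "x \<noteq> 0"
      then have "(e / norm x) *\<^sub>R x \<in> polar L"
        using e by (intro subsetD[OF e(2)]) (auto simp: dist_norm)
      then have "x \<bullet> (e / norm x) *\<^sub>R x \<le> 0"
        using R True by blast
      then show False
        using \<open>x \<noteq> 0\<close> e(1) inner_gt_zero_iff[of x]
        by (simp add: divide_le_0_iff mult_le_0_iff del: inner_gt_zero_iff)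
    qed
    then show ?thesis
      using True \<open>0 \<in> L\<close> by (force simp: homothet_def)
  next
    case False
    then have "\<rho> > 0" using assms(4) by simp
    have "x /\<^sub>R \<rho> \<in> L"
    proof (rule ccontr)
      assume "x /\<^sub>R \<rho> \<notin> L"
      then obtain a \<beta> where a: "a \<bullet> (x /\<^sub>R \<rho>) < \<beta>" "\<And>w. w \<in> L \<Longrightarrow> \<beta> < a \<bullet> w"
        using separating_hyperplane_closed_point[of L "x /\<^sub>R \<rho>"] assms(1,2) compact_imp_closed
        by blast
      have "\<beta> < 0" using a(2)[OF \<open>0 \<in> L\<close>] by simp
      have "a /\<^sub>R \<beta> \<in> polar L"
        using a(2) \<open>\<beta> < 0\<close> by (force simp: polar_def inner_commute field_simps)
      then have "x \<bullet> (a /\<^sub>R \<beta>) \<le> \<rho>" using R by blast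
      then show False
        using a(1) \<open>\<beta> < 0\<close> \<open>\<rho> > 0\<close> by (simp add: inner_commute field_simps)
    qed
    then have "\<rho> *\<^sub>R (x /\<^sub>R \<rho>) + 0 \<in> homothet \<rho> 0 L"
      unfolding homothet_def by blast
    then show ?thesis using \<open>\<rho> > 0\<close> by simp
  qed
qed

text \<open>The gauge is the support function of the polar. This makes the relative diameter a maximum of
  linear functionals, which is what the perturbation argument differentiates.\<close>

lemma gauge_fun_polar:
  fixes L :: "'a::euclidean_space set"
  assumes "compact L" "convex L" "0 \<in> interior L"
  shows inner_le_gauge_fun: "b \<in> polar L \<Longrightarrow> x \<bullet> b \<le> gauge_fun L x"
    and gauge_fun_attained: "\<exists>b\<in>polar L. x \<bullet> b = gauge_fun L x"
proof -
  have 0: "0 \<in> polar L" by (simp add: polar_def)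
  have "continuous_on (polar L) (\<lambda>b. x \<bullet> b)"
    by (intro continuous_intros)
  then obtain b0 where b0: "b0 \<in> polar L" "\<And>b. b \<in> polar L \<Longrightarrow> x \<bullet> b \<le> x \<bullet> b0"
    using continuous_attains_sup[OF compact_polar[OF assms(3)]] 0 by blast
  have "0 \<le> x \<bullet> b0" using b0(2)[OF 0] by simp
  then have g: "gauge_fun L x = x \<bullet> b0"
    unfolding gauge_fun_def using b0 mem_scaled_iff_polar[OF assms]
    by (intro Least_equality) auto
  show "b \<in> polar L \<Longrightarrow> x \<bullet> b \<le> gauge_fun L x" using b0 g by simp
  show "\<exists>b\<in>polar L. x \<bullet> b = gauge_fun L x" using b0 g by force
qed

lemma gauge_fun_pos:
  fixes L :: "'a::euclidean_space set"
  assumes "compact L" "convex L" "0 \<in> interior L" and "x \<noteq> 0"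
  shows "0 < gauge_fun L x"
proof -
  obtain e where e: "e > 0" "cball 0 e \<subseteq> polar L"
    using polar_contains_cball compact_imp_bounded assms(1) by blast
  have "(e / norm x) *\<^sub>R x \<in> polar L"
    using e assms(4) by (intro subsetD[OF e(2)]) (auto simp: dist_norm)
  then have "x \<bullet> (e / norm x) *\<^sub>R x \<le> gauge_fun L x"
    using inner_le_gauge_fun[OF assms(1-3)] by blast
  moreover have "0 < x \<bullet> (e / norm x) *\<^sub>R x"
    using e assms(4) by simp
  ultimately show ?thesis by linarith
qed

text \<open>By the polar description of the gauge, the diameter is the maximum of the continuous function
  \<open>(y - z) \<bullet> b\<close> over the compact set \<open>K \<times> K \<times> polar L\<close>.\<close>

lemma rel_diameter_attained:
  fixes K L :: "'a::euclidean_space set"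
  assumes L: "compact L" "convex L" "0 \<in> interior L" and K: "compact K" "K \<noteq> {}"
  shows gauge_le_rel_diameter: "y \<in> K \<Longrightarrow> z \<in> K \<Longrightarrow> gauge_fun L (y - z) \<le> rel_diameter K L"
    and rel_diameter_eq_gauge: "\<exists>y\<in>K. \<exists>z\<in>K. gauge_fun L (y - z) = rel_diameter K L"
proof -
  have "0 \<in> polar L" by (simp add: polar_def)
  have X1: "compact (K \<times> K \<times> polar L)"
    using K compact_polar[OF L(3)] by (intro compact_Times)
  have X2: "K \<times> K \<times> polar L \<noteq> {}"
    using K \<open>0 \<in> polar L\<close> by blast
  have X3: "continuous_on (K \<times> K \<times> polar L) (\<lambda>s. (fst s - fst (snd s)) \<bullet> snd (snd s))"
    by (intro continuous_intros)
  obtain t where t: "t \<in> K \<times> K \<times> polar L"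
    "\<And>s. s \<in> K \<times> K \<times> polar L \<Longrightarrow>
       (fst s - fst (snd s)) \<bullet> snd (snd s) \<le> (fst t - fst (snd t)) \<bullet> snd (snd t)"
    using continuous_attains_sup[OF X1 X2 X3] by blast
  obtain y0 z0 b0 where [simp]: "t = (y0, z0, b0)" by (cases t)
  have max: "gauge_fun L (y - z) \<le> (y0 - z0) \<bullet> b0" if "y \<in> K" "z \<in> K" for y z
  proof -
    obtain b where "b \<in> polar L" "(y - z) \<bullet> b = gauge_fun L (y - z)"
      using gauge_fun_attained[OF L] by blast
    then show ?thesis using t(2)[of "(y, z, b)"] that by simp
  qed
  have eq: "gauge_fun L (y0 - z0) = (y0 - z0) \<bullet> b0"
    using max[of y0 z0] inner_le_gauge_fun[OF L, of b0 "y0 - z0"] t(1) by force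
  have "rel_diameter K L = gauge_fun L (y0 - z0)"
    unfolding rel_diameter_def
  proof (rule Greatest_equality)
    show "\<exists>x\<in>K. \<exists>y\<in>K. gauge_fun L (y0 - z0) = gauge_fun L (x - y)"
      using t(1) by auto
    show "d \<le> gauge_fun L (y0 - z0)" if "\<exists>x\<in>K. \<exists>y\<in>K. d = gauge_fun L (x - y)" for d
      using that max eq by auto
  qed
  then show "y \<in> K \<Longrightarrow> z \<in> K \<Longrightarrow> gauge_fun L (y - z) \<le> rel_diameter K L"
    and "\<exists>y\<in>K. \<exists>z\<in>K. gauge_fun L (y - z) = rel_diameter K L"
    using max eq t(1) by auto
qed

lemma rel_diameter_pos:
  fixes K L :: "'a::euclidean_space set"
  assumes L: "compact L" "convex L" "0 \<in> interior L" and K: "convex_body K"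
  shows "0 < rel_diameter K L"
proof -
  obtain p e where pe: "e > 0" "cball p e \<subseteq> K"
    using K by (auto simp: convex_body_def mem_interior_cball)
  obtain i :: 'a where i: "i \<in> Basis" using nonempty_Basis by blast
  have 1: "p \<in> K" "p + e *\<^sub>R i \<in> K"
    using pe i by (auto intro!: subsetD[OF pe(2)] simp: dist_norm)
  have "0 < gauge_fun L (p + e *\<^sub>R i - p)"
    using pe(1) i by (intro gauge_fun_pos[OF L]) auto
  also have "\<dots> \<le> rel_diameter K L"
    using 1 K by (intro gauge_le_rel_diameter[OF L]) (auto simp: convex_body_def)
  finally show ?thesis .
qed

text \<open>This starts the maximisation in the inradius: it shows that the supremum is over a set
  with a positive element.\<close>

lemma homothet_subset_small:
  fixes K L :: "'a::euclidean_space set"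
  assumes "bounded L" and "interior K \<noteq> {}"
  obtains \<rho> c where "\<rho> > 0" and "homothet \<rho> c L \<subseteq> K"
proof -
  obtain M where M: "M > 0" "\<And>x. x \<in> L \<Longrightarrow> norm x \<le> M"
    using assms(1) by (auto simp: bounded_pos)
  obtain p e where pe: "e > 0" "cball p e \<subseteq> K"
    using assms(2) by (auto simp: mem_interior_cball)
  have "(e / M) *\<^sub>R x + p \<in> K" if "x \<in> L" for x
  proof -
    have "e * norm x \<le> e * M" using M(2)[OF that] pe(1) by simp
    then have "norm ((e / M) *\<^sub>R x) \<le> e" using M pe by (simp add: field_simps)
    then show ?thesis by (intro subsetD[OF pe(2)]) (auto simp: dist_norm)
  qed
  then show ?thesis using that[of "e / M" p] M pe by (auto simp: homothet_def)
qed

text \<open>The admissible pairs \<open>(\<rho>, c)\<close> form a compact set: \<open>c\<close> itself lies in \<open>K\<close> because \<open>0 \<in> L\<close>, and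
  a nonzero point of \<open>L\<close> bounds \<open>\<rho>\<close> in terms of the size of \<open>K\<close>.\<close>

lemma rel_inradius_attained:
  fixes K L :: "'a::euclidean_space set"
  assumes L: "bounded L" "0 \<in> interior L" and K: "compact K" "interior K \<noteq> {}"
  shows rel_inradius_ge: "0 \<le> \<rho> \<Longrightarrow> homothet \<rho> c L \<subseteq> K \<Longrightarrow> \<rho> \<le> rel_inradius K L"
    and rel_inradius_homothet: "\<exists>c. homothet (rel_inradius K L) c L \<subseteq> K"
    and rel_inradius_pos: "0 < rel_inradius K L"
proof -
  define P where "P = {(\<rho>::real, c). 0 \<le> \<rho> \<and> homothet \<rho> c L \<subseteq> K}"
  obtain e where e: "e > 0" "cball 0 e \<subseteq> L"
    using L(2) by (auto simp: mem_interior_cball)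
  obtain i :: 'a where i: "i \<in> Basis" using nonempty_Basis by blast
  have "0 \<in> L" "e *\<^sub>R i \<in> L"
    using e i by (auto intro!: subsetD[OF e(2)])
  obtain B where B: "B > 0" "\<And>x. x \<in> K \<Longrightarrow> norm x \<le> B"
    using compact_imp_bounded[OF K(1)] by (auto simp: bounded_pos)
  have "P \<subseteq> {0..2 * B / e} \<times> K"
  proof safe
    fix \<rho> c assume "(\<rho>, c) \<in> P"
    then have p: "0 \<le> \<rho>" "\<And>w. w \<in> L \<Longrightarrow> \<rho> *\<^sub>R w + c \<in> K"
      by (auto simp: P_def homothet_def)
    show c: "c \<in> K" using p(2)[OF \<open>0 \<in> L\<close>] by simp
    have "norm (\<rho> *\<^sub>R e *\<^sub>R i) \<le> norm (\<rho> *\<^sub>R e *\<^sub>R i + c) + norm c"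
      using norm_triangle_ineq4[of "\<rho> *\<^sub>R e *\<^sub>R i + c" c] by simp
    also have "\<dots> \<le> B + B"
      using p(2)[OF \<open>e *\<^sub>R i \<in> L\<close>] c B(2) by (intro add_mono) auto
    finally show "\<rho> \<in> {0..2 * B / e}"
      using p(1) e(1) i by (simp add: field_simps)
  qed
  moreover have "closed P"
  proof -
    have "P = {q. 0 \<le> fst q} \<inter> (\<Inter>w\<in>L. (\<lambda>q. fst q *\<^sub>R w + snd q) -` K)"
      by (auto simp: P_def homothet_def)
    moreover have "closed ((\<lambda>q::real \<times> 'a. fst q *\<^sub>R w + snd q) -` K)" for w
      using K(1) by (intro closed_vimage compact_imp_closed continuous_intros)
    moreover have "closed {q :: real \<times> 'a. 0 \<le> fst q}"
      by (intro closed_Collect_le continuous_intros)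
    ultimately show ?thesis by auto
  qed
  ultimately have "compact (({0..2 * B / e} \<times> K) \<inter> P)" and "({0..2 * B / e} \<times> K) \<inter> P = P"
    using K(1) by (auto intro!: compact_Int_closed compact_Times)
  then have "compact P" by simp
  obtain \<rho>1 c1 where 1: "\<rho>1 > 0" "homothet \<rho>1 c1 L \<subseteq> K"
    using homothet_subset_small[OF L(1) K(2)] by blast
  then have "P \<noteq> {}" by (force simp: P_def)
  obtain q where q: "q \<in> P" "\<And>p. p \<in> P \<Longrightarrow> fst p \<le> fst q"
    using continuous_attains_sup[OF \<open>compact P\<close> \<open>P \<noteq> {}\<close> continuous_on_fst[OF continuous_on_id]]
    by blast
  obtain r0 c0 where [simp]: "q = (r0, c0)" by (cases q)
  have r: "rel_inradius K L = r0"
    unfolding rel_inradius_def using q by (intro Greatest_equality) (auto simp: P_def)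
  show *: "0 \<le> \<rho> \<Longrightarrow> homothet \<rho> c L \<subseteq> K \<Longrightarrow> \<rho> \<le> rel_inradius K L" for \<rho> c
    using q(2)[of "(\<rho>, c)"] r by (auto simp: P_def)
  show "\<exists>c. homothet (rel_inradius K L) c L \<subseteq> K"
    using q(1) r by (auto simp: P_def)
  show "0 < rel_inradius K L" using *[of \<rho>1 c1] 1 by simp
qed

lemma convex_body_matrix_image:
  fixes K :: "(real^'n) set" and A :: "real^'n^'n"
  assumes "convex_body K" and "det A \<noteq> 0"
  shows "convex_body ((*v) A ` K)"
proof -
  have "inj ((*v) A)"
    using assms(2) by (simp add: invertible_det_nz[symmetric] inj_matrix_vector_mult)
  then have "interior ((*v) A ` K) = (*v) A ` interior K"
    by (intro interior_injective_linear_image) auto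
  moreover have "compact ((*v) A ` K)"
    using assms(1) by (intro compact_continuous_image)
      (auto simp: convex_body_def intro!: linear_continuous_on matrix_vector_mul_bounded_linear)
  moreover have "convex ((*v) A ` K)"
    using assms(1) by (intro convex_linear_image) (auto simp: convex_body_def)
  ultimately show ?thesis
    using assms(1) by (simp add: convex_body_def)
qed

section \<open>First-order perturbations of the body\<close>

text \<open>Where \<open>\<phi>\<close> is maximal, the term \<open>t \<psi>\<close> decreases the value at once; where \<open>\<psi> \<ge> 0\<close>, a compact
  region, \<open>\<phi>\<close> stays away from its maximum by a fixed margin, which \<open>t \<psi>\<close> cannot fill for small \<open>t\<close>.\<close>

lemma strict_decrease_of_max:
  fixes \<phi> \<psi> :: "'b::topological_space \<Rightarrow> real"
  assumes X: "compact X" and c: "continuous_on X \<phi>" "continuous_on X \<psi>"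
    and le: "\<And>x. x \<in> X \<Longrightarrow> \<phi> x \<le> d"
    and neg: "\<And>x. x \<in> X \<Longrightarrow> \<phi> x = d \<Longrightarrow> \<psi> x < 0"
  shows "\<exists>\<delta>>0. \<forall>t. 0 < t \<and> t < \<delta> \<longrightarrow> (\<forall>x\<in>X. \<phi> x + t * \<psi> x < d)"
proof (cases "\<forall>x\<in>X. \<psi> x < 0")
  case True
  have "\<phi> x + t * \<psi> x < d" if "x \<in> X" "0 < t" for x t
    using le[OF that(1)] mult_pos_neg[OF that(2), of "\<psi> x"] True that(1) by fastforce
  then show ?thesis by (intro exI[of _ 1]) auto
next
  case False
  define C where "C = {x\<in>X. 0 \<le> \<psi> x}"
  have "C \<noteq> {}" using False by (force simp: C_def)
  have "closedin (top_of_set X) C"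
  proof -
    have "C = X \<inter> \<psi> -` {0..}" by (auto simp: C_def)
    then show ?thesis
      using continuous_closedin_preimage[OF c(2), of "{0..}"] by simp
  qed
  then have "compact C"
    using X closedin_compact by blast
  have "continuous_on C \<phi>" "continuous_on C \<psi>"
    using c by (auto intro: continuous_on_subset simp: C_def)
  obtain x0 where x0: "x0 \<in> C" "\<And>x. x \<in> C \<Longrightarrow> \<phi> x \<le> \<phi> x0"
    using continuous_attains_sup[OF \<open>compact C\<close> \<open>C \<noteq> {}\<close> \<open>continuous_on C \<phi>\<close>] by blast
  obtain x1 where x1: "x1 \<in> C" "\<And>x. x \<in> C \<Longrightarrow> \<psi> x \<le> \<psi> x1"
    using continuous_attains_sup[OF \<open>compact C\<close> \<open>C \<noteq> {}\<close> \<open>continuous_on C \<psi>\<close>] by blast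
  have "\<phi> x0 < d"
    using le[of x0] neg[of x0] x0(1) by (force simp: C_def)
  have "0 \<le> \<psi> x1" using x1(1) by (simp add: C_def)
  define \<delta> where "\<delta> = (d - \<phi> x0) / (\<psi> x1 + 1)"
  have "\<delta> > 0" using \<open>\<phi> x0 < d\<close> \<open>0 \<le> \<psi> x1\<close> by (simp add: \<delta>_def)
  moreover have "\<phi> x + t * \<psi> x < d" if t: "0 < t" "t < \<delta>" and x: "x \<in> X" for t x
  proof (cases "x \<in> C")
    case True
    have "t * \<psi> x \<le> t * (\<psi> x1 + 1)"
      using x1(2)[OF True] t by (intro mult_left_mono) auto
    also have "\<dots> < \<delta> * (\<psi> x1 + 1)"
      using t \<open>0 \<le> \<psi> x1\<close> by (intro mult_strict_right_mono) auto
    also have "\<dots> = d - \<phi> x0"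
      using \<open>0 \<le> \<psi> x1\<close> by (simp add: \<delta>_def)
    finally show ?thesis using x0(2)[OF True] by linarith
  next
    case False
    then have "t * \<psi> x < 0" using x t by (auto simp: C_def intro: mult_pos_neg)
    then show ?thesis using le[OF x] by linarith
  qed
  ultimately show ?thesis by blast
qed

text \<open>On \<open>K \<times> K \<times> polar L\<close> the diameter triples are the points where \<open>(y - z) \<bullet> b\<close> is maximal, and
  the perturbation adds \<open>t (b \<bullet> A (y - z))\<close> to this function.\<close>

lemma rel_diameter_decreases:
  fixes K L :: "'a::euclidean_space set" and A :: "'a \<Rightarrow> 'a"
  assumes L: "compact L" "convex L" "0 \<in> interior L" and K: "compact K" "K \<noteq> {}"
    and A: "linear A"
    and neg: "\<And>y z b. diameter_triple K L y z b \<Longrightarrow> b \<bullet> A (y - z) < 0"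
  shows "\<exists>\<delta>>0. \<forall>t. 0 < t \<and> t < \<delta> \<longrightarrow> rel_diameter ((\<lambda>x. x + t *\<^sub>R A x) ` K) L < rel_diameter K L"
proof -
  have cA: "continuous_on S (\<lambda>x. A (g x))" if "continuous_on S g"
    for S :: "('a \<times> 'a \<times> 'a) set" and g
    using that A by (rule linear_continuous_on_compose)
  define X where "X = K \<times> K \<times> polar L"
  define \<phi> \<psi> where "\<phi> = (\<lambda>s::'a \<times> 'a \<times> 'a. (fst s - fst (snd s)) \<bullet> snd (snd s))"
    and "\<psi> = (\<lambda>s::'a \<times> 'a \<times> 'a. snd (snd s) \<bullet> A (fst s - fst (snd s)))"
  have "\<exists>\<delta>>0. \<forall>t. 0 < t \<and> t < \<delta> \<longrightarrow> (\<forall>s\<in>X. \<phi> s + t * \<psi> s < rel_diameter K L)"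
  proof (rule strict_decrease_of_max)
    show "compact X"
      unfolding X_def using K compact_polar[OF L(3)] by (intro compact_Times)
    show "continuous_on X \<phi>" "continuous_on X \<psi>"
      unfolding \<phi>_def \<psi>_def by (intro continuous_intros cA)+
    fix s assume "s \<in> X"
    then obtain y z b where [simp]: "s = (y, z, b)" and s: "y \<in> K" "z \<in> K" "b \<in> polar L"
      by (auto simp: X_def)
    have 1: "\<phi> s \<le> gauge_fun L (y - z)" "gauge_fun L (y - z) \<le> rel_diameter K L"
      using inner_le_gauge_fun[OF L s(3)] gauge_le_rel_diameter[OF L K s(1,2)]
      by (auto simp: \<phi>_def)
    then show "\<phi> s \<le> rel_diameter K L" by linarith
    assume "\<phi> s = rel_diameter K L"
    then have "diameter_triple K L y z b"
      using s 1 by (auto simp: diameter_triple_def \<phi>_def)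
    then show "\<psi> s < 0" using neg by (simp add: \<psi>_def)
  qed
  then obtain \<delta> where \<delta>: "\<delta> > 0"
    "\<And>t s. 0 < t \<Longrightarrow> t < \<delta> \<Longrightarrow> s \<in> X \<Longrightarrow> \<phi> s + t * \<psi> s < rel_diameter K L"
    by blast
  have "rel_diameter ((\<lambda>x. x + t *\<^sub>R A x) ` K) L < rel_diameter K L" if t: "0 < t" "t < \<delta>" for t
  proof -
    have "continuous_on K A" using linear_continuous_on_compose[OF continuous_on_id A] by simp
    then have "compact ((\<lambda>x. x + t *\<^sub>R A x) ` K)"
      using K by (intro compact_continuous_image continuous_intros)
    then obtain y z where yz: "y \<in> K" "z \<in> K"
      "gauge_fun L ((y + t *\<^sub>R A y) - (z + t *\<^sub>R A z)) = rel_diameter ((\<lambda>x. x + t *\<^sub>R A x) ` K) L"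
      using rel_diameter_eq_gauge[OF L, of "(\<lambda>x. x + t *\<^sub>R A x) ` K"] K by auto
    obtain b where b: "b \<in> polar L"
      "((y + t *\<^sub>R A y) - (z + t *\<^sub>R A z)) \<bullet> b = rel_diameter ((\<lambda>x. x + t *\<^sub>R A x) ` K) L"
      using gauge_fun_attained[OF L] yz(3) by metis
    have "((y + t *\<^sub>R A y) - (z + t *\<^sub>R A z)) \<bullet> b = \<phi> (y, z, b) + t * \<psi> (y, z, b)"
      by (simp add: \<phi>_def \<psi>_def linear_diff[OF A] inner_commute[of b] inner_add_left
          inner_diff_left right_diff_distrib)
    then show ?thesis using \<delta>(2)[OF t, of "(y, z, b)"] b yz by (simp add: X_def)
  qed
  then show ?thesis using \<delta>(1) by blast
qed

text \<open>If some \<open>p \<in> C\<close> leaves the perturbed body, a unit vector \<open>a\<close> separates it from that body.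
  Comparing \<open>p\<close> with its own image shows \<open>a \<bullet> (A p + u) \<le> 0\<close>. By hypothesis such pairs \<open>(p, a)\<close> are
  no contact pairs, and by compactness \<open>K\<close> extends beyond \<open>p\<close> in direction \<open>a\<close> by a fixed margin
  \<open>\<epsilon>\<close>, so that a displacement of order \<open>t\<close> cannot separate them.\<close>

lemma perturbation_keeps_subset:
  fixes K C :: "'a::euclidean_space set" and A :: "'a \<Rightarrow> 'a"
  assumes K: "compact K" "convex K" and C: "compact C" "C \<subseteq> K" and A: "linear A"
    and pos: "\<And>p a. p \<in> C \<Longrightarrow> a \<noteq> 0 \<Longrightarrow> \<forall>w\<in>K. a \<bullet> w \<le> a \<bullet> p \<Longrightarrow> 0 < a \<bullet> (A p + u)"
  shows "\<exists>\<delta>>0. \<forall>t. 0 < t \<and> t < \<delta> \<longrightarrow> C \<subseteq> (\<lambda>x. x + t *\<^sub>R (A x + u)) ` K"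
proof -
  define X where "X = (C \<times> sphere 0 1) \<inter> {q. snd q \<bullet> (A (fst q) + u) \<le> 0}"
  \<comment> \<open>\<open>U e\<close> collects the pairs \<open>(p, a)\<close> at which \<open>K\<close> extends beyond \<open>p\<close> by more than \<open>e\<close>. Covering
    by these open sets replaces continuity of the support function of \<open>K\<close>.\<close>
  define U where "U e = (\<Union>x\<in>K. {q::'a \<times> 'a. snd q \<bullet> fst q + e < snd q \<bullet> x})" for e
  have "continuous_on UNIV (\<lambda>q::'a \<times> 'a. A (fst q))"
    by (rule linear_continuous_on_compose[OF _ A]) (intro continuous_intros)
  then have "closed {q::'a \<times> 'a. snd q \<bullet> (A (fst q) + u) \<le> 0}"
    by (intro closed_Collect_le continuous_intros)
  then have "compact X"
    unfolding X_def using C(1) by (intro compact_Int_closed compact_Times) auto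
  moreover have "open (U e)" for e
    unfolding U_def by (intro open_UN ballI open_Collect_less continuous_intros)
  moreover have "X \<subseteq> (\<Union>e\<in>{0<..}. U e)"
  proof
    fix q assume "q \<in> X"
    then obtain p a where [simp]: "q = (p, a)" and q: "p \<in> C" "norm a = 1" "a \<bullet> (A p + u) \<le> 0"
      by (cases q) (auto simp: X_def)
    have "\<not> (\<forall>w\<in>K. a \<bullet> w \<le> a \<bullet> p)"
      using pos[of p a] q by force
    then obtain x where x: "x \<in> K" "a \<bullet> p < a \<bullet> x" by (auto simp: not_le)
    then have "q \<in> U ((a \<bullet> x - a \<bullet> p) / 2)"
      unfolding U_def by (auto simp: field_simps intro!: bexI[of _ x])
    then show "q \<in> (\<Union>e\<in>{0<..}. U e)"
      using x by (intro UN_I[of "(a \<bullet> x - a \<bullet> p) / 2"]) auto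
  qed
  ultimately obtain F where F: "F \<subseteq> {0<..}" "finite F" "X \<subseteq> (\<Union>e\<in>F. U e)"
    by (rule compactE_image)
  define \<epsilon> where "\<epsilon> = Min (insert 1 F)"
  have "\<epsilon> > 0" using F(1,2) by (auto simp: \<epsilon>_def)
  have margin: "\<exists>x\<in>K. a \<bullet> p + \<epsilon> < a \<bullet> x" if pa: "(p, a) \<in> X" for p a
  proof -
    obtain e where "e \<in> F" "(p, a) \<in> U e" using F(3) pa by blast
    moreover have "\<epsilon> \<le> e" using \<open>e \<in> F\<close> F(2) by (simp add: \<epsilon>_def)
    ultimately show ?thesis by (force simp: U_def)
  qed
  have cA: "continuous_on K (\<lambda>x. A x + u)"
    using linear_continuous_on_compose[OF continuous_on_id A] by (intro continuous_intros) simp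
  then obtain B where B: "B > 0" "\<And>x. x \<in> K \<Longrightarrow> norm (A x + u) \<le> B"
    using compact_imp_bounded[OF compact_continuous_image[OF cA K(1)]]
    by (auto simp: bounded_pos)
  have "C \<subseteq> (\<lambda>x. x + t *\<^sub>R (A x + u)) ` K" if t: "0 < t" "t < \<epsilon> / B" for t
  proof
    let ?f = "\<lambda>x. x + t *\<^sub>R (A x + u)"
    fix p assume p: "p \<in> C"
    show "p \<in> ?f ` K"
    proof (rule ccontr)
      assume np: "p \<notin> ?f ` K"
      have "?f ` K = (\<lambda>y. t *\<^sub>R u + y) ` (\<lambda>x. x + t *\<^sub>R A x) ` K"
        by (simp add: image_image algebra_simps)
      moreover have "linear (\<lambda>x. x + t *\<^sub>R A x)"
        using A by (intro linear_compose_add linear_compose_scale_right linear_ident)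
      ultimately have "convex (?f ` K)"
        using K(2) by (simp add: convex_translation convex_linear_image)
      moreover have "closed (?f ` K)"
        using K(1) by (intro compact_imp_closed compact_continuous_image continuous_on_add
            continuous_on_scaleR continuous_on_const continuous_on_id cA)
      ultimately obtain a' \<beta> where a': "a' \<bullet> p < \<beta>" "\<And>x. x \<in> K \<Longrightarrow> \<beta> < a' \<bullet> ?f x"
        using separating_hyperplane_closed_point[of "?f ` K" p] np by blast
      have "p \<in> K" using p C(2) by blast
      then have "a' \<noteq> 0" using a'(1) a'(2)[of p] by auto
      define a where "a = - a' /\<^sub>R norm a'"
      have a: "norm a = 1" using \<open>a' \<noteq> 0\<close> by (simp add: a_def)
      have sep: "a \<bullet> ?f x < a \<bullet> p" if "x \<in> K" for x
      proof -
        have "a' \<bullet> p < a' \<bullet> ?f x" using a'(1) a'(2)[OF that] by linarith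
        then have "a' \<bullet> p / norm a' < a' \<bullet> ?f x / norm a'"
          using \<open>a' \<noteq> 0\<close> by (intro divide_strict_right_mono) auto
        then show ?thesis by (simp add: a_def divide_inverse mult.commute)
      qed
      have "t * (a \<bullet> (A p + u)) < 0"
        using sep[OF \<open>p \<in> K\<close>] by (simp add: inner_add_right)
      then have "a \<bullet> (A p + u) \<le> 0"
        using t(1) by (simp add: mult_less_0_iff)
      then have "(p, a) \<in> X" using p a by (simp add: X_def)
      then obtain x where x: "x \<in> K" "a \<bullet> p + \<epsilon> < a \<bullet> x" using margin by blast
      have "\<bar>a \<bullet> (A x + u)\<bar> \<le> B"
        using Cauchy_Schwarz_ineq2[of a "A x + u"] B(2)[OF x(1)] a by simp
      then have "t * - B \<le> t * (a \<bullet> (A x + u))"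
        using t(1) by (intro mult_left_mono) auto
      moreover have "t * B < \<epsilon>" using t B(1) by (simp add: field_simps)
      moreover have "a \<bullet> x + t * (a \<bullet> (A x + u)) < a \<bullet> p"
        using sep[OF x(1)] by (simp add: inner_add_right)
      ultimately show False using x(2) by simp
    qed
  qed
  then show ?thesis using \<open>\<epsilon> > 0\<close> B(1) by (intro exI[of _ "\<epsilon> / B"]) auto
qed

lemma det_perturbed_identity_nz:
  fixes A :: "real^'n^'n"
  shows "\<exists>\<delta>>0. \<forall>t. 0 < t \<and> t < \<delta> \<longrightarrow> det (mat 1 + t *\<^sub>R A) \<noteq> 0"
proof -
  obtain B where B: "B > 0" "\<And>x. norm (A *v x) \<le> norm x * B"
    using bounded_linear.pos_bounded[OF matrix_vector_mul_bounded_linear[of A]] by blast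
  have "det (mat 1 + t *\<^sub>R A) \<noteq> 0" if t: "0 < t" "t < 1 / B" for t
  proof -
    have "x = 0" if "(mat 1 + t *\<^sub>R A) *v x = 0" for x
    proof (rule ccontr)
      assume "x \<noteq> 0"
      have "x = - (t *\<^sub>R (A *v x))"
        using that by (simp add: matrix_vector_mult_add_rdistrib scaleR_matrix_vector_assoc[symmetric]
            eq_neg_iff_add_eq_0)
      then have "norm x = norm (- (t *\<^sub>R (A *v x)))"
        by (rule arg_cong)
      also have "\<dots> = t * norm (A *v x)"
        using t(1) by simp
      also have "\<dots> \<le> (t * B) * norm x"
        using mult_left_mono[OF B(2)[of x], of t] t(1) by (simp add: ac_simps)
      finally have "1 \<le> t * B" using \<open>x \<noteq> 0\<close> by simp
      then show False using t B(1) by (simp add: field_simps)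
    qed
    then show ?thesis
      by (simp add: invertible_det_nz[symmetric] invertible_left_inverse matrix_left_invertible_ker)
  qed
  then show ?thesis using B(1) by (intro exI[of _ "1 / B"]) auto
qed

section \<open>Vanishing combinations and rank-one matrices\<close>

text \<open>Vectors of weight zero are dropped, and a vector in both images is assigned to the
  first one. Either index range may be empty, but not both.\<close>

lemma conic_combination_of_images:
  fixes f :: "'p \<Rightarrow> 'v::real_vector" and g :: "'q \<Rightarrow> 'v"
  assumes "0 \<in> convex hull (f ` P \<union> g ` Q)"
  obtains N M :: nat and p q and lam \<mu> :: "nat \<Rightarrow> real"
  where "1 \<le> N + M"
    and "\<forall>i\<in>{1..N}. p i \<in> P \<and> 0 < lam i"
    and "\<forall>j\<in>{1..M}. q j \<in> Q \<and> 0 < \<mu> j"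
    and "(\<Sum>i=1..N. lam i *\<^sub>R f (p i)) + (\<Sum>j=1..M. \<mu> j *\<^sub>R g (q j)) = 0"
proof -
  obtain S u where S: "finite S" "S \<subseteq> f ` P \<union> g ` Q" "\<forall>v\<in>S. 0 \<le> u v" "sum u S = 1"
    "(\<Sum>v\<in>S. u v *\<^sub>R v) = 0"
    using assms by (auto simp: convex_hull_explicit)
  define S1 where "S1 = {v\<in>S. 0 < u v} \<inter> f ` P"
  define S2 where "S2 = {v\<in>S. 0 < u v} - f ` P"
  have fin: "finite S1" "finite S2" using S(1) by (auto simp: S1_def S2_def)
  have zero: "u v = 0" if "v \<in> S - (S1 \<union> S2)" for v
    using that S(3) by (force simp: S1_def S2_def)
  have sub: "S1 \<union> S2 \<subseteq> S" by (auto simp: S1_def S2_def)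
  have disj: "S1 \<inter> S2 = {}" by (auto simp: S1_def S2_def)
  have "sum u (S1 \<union> S2) = sum u S"
    using zero by (intro sum.mono_neutral_left S(1) sub) auto
  then have ne: "S1 \<union> S2 \<noteq> {}" using S(4) by auto
  have "(\<Sum>v\<in>S1 \<union> S2. u v *\<^sub>R v) = (\<Sum>v\<in>S. u v *\<^sub>R v)"
    using zero by (intro sum.mono_neutral_left S(1) sub) auto
  then have sum0: "(\<Sum>v\<in>S1. u v *\<^sub>R v) + (\<Sum>v\<in>S2. u v *\<^sub>R v) = 0"
    using S(5) fin disj by (simp add: sum.union_disjoint)
  obtain h1 where h1: "bij_betw h1 {1..card S1} S1"
    using ex_bij_betw_nat_finite_1[OF fin(1)] by blast
  obtain h2 where h2: "bij_betw h2 {1..card S2} S2"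
    using ex_bij_betw_nat_finite_1[OF fin(2)] by blast
  define p where "p i = inv_into P f (h1 i)" for i
  define q where "q j = inv_into Q g (h2 j)" for j
  have m1: "h1 i \<in> S1" if "i \<in> {1..card S1}" for i
    using bij_betwE[OF h1] that by blast
  have m2: "h2 j \<in> S2" if "j \<in> {1..card S2}" for j
    using bij_betwE[OF h2] that by blast
  have p: "p i \<in> P" "f (p i) = h1 i" if "i \<in> {1..card S1}" for i
    using m1[OF that] unfolding p_def S1_def by (auto simp: inv_into_into f_inv_into_f)
  have S2g: "S2 \<subseteq> g ` Q" using S(2) by (auto simp: S2_def)
  have q: "q j \<in> Q" "g (q j) = h2 j" if "j \<in> {1..card S2}" for j
    using subsetD[OF S2g m2[OF that]] unfolding q_def by (auto simp: inv_into_into f_inv_into_f)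
  show ?thesis
  proof (rule that[of "card S1" "card S2" p "\<lambda>i. u (h1 i)" q "\<lambda>j. u (h2 j)"])
    show "1 \<le> card S1 + card S2" using ne fin by (auto simp: Suc_le_eq card_gt_0_iff)
    show "\<forall>i\<in>{1..card S1}. p i \<in> P \<and> 0 < u (h1 i)"
      using p(1) m1 by (simp add: S1_def)
    show "\<forall>j\<in>{1..card S2}. q j \<in> Q \<and> 0 < u (h2 j)"
      using q(1) m2 by (simp add: S2_def)
    have "(\<Sum>i=1..card S1. u (h1 i) *\<^sub>R f (p i)) = (\<Sum>i=1..card S1. u (h1 i) *\<^sub>R h1 i)"
      using p(2) by (intro sum.cong) auto
    also have "\<dots> = (\<Sum>v\<in>S1. u v *\<^sub>R v)"
      by (rule sum.reindex_bij_betw[OF h1])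
    finally have 1: "(\<Sum>i=1..card S1. u (h1 i) *\<^sub>R f (p i)) = (\<Sum>v\<in>S1. u v *\<^sub>R v)" .
    have "(\<Sum>j=1..card S2. u (h2 j) *\<^sub>R g (q j)) = (\<Sum>j=1..card S2. u (h2 j) *\<^sub>R h2 j)"
      using q(2) by (intro sum.cong) auto
    also have "\<dots> = (\<Sum>v\<in>S2. u v *\<^sub>R v)"
      by (rule sum.reindex_bij_betw[OF h2])
    finally show "(\<Sum>i=1..card S1. u (h1 i) *\<^sub>R f (p i)) + (\<Sum>j=1..card S2. u (h2 j) *\<^sub>R g (q j)) = 0"
      using 1 sum0 by simp
  qed
qed

text \<open>This is the matrix \<open>a x\<^sup>T\<close>, in this order, so that \<open>inner_outer\<close> turns a linear functional on
  matrices into the bilinear form \<open>a \<bullet> (A x)\<close>; the operator \<open>v \<mapsto> (v \<bullet> a) x\<close> is then multiplication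
  from the left, \<open>v v* outer a x\<close>.\<close>

definition outer :: "real^'m \<Rightarrow> real^'n \<Rightarrow> real^'n^'m" where
  "outer a x = (\<chi> i j. a $ i * x $ j)"

lemma inner_outer: "A \<bullet> outer a x = a \<bullet> (A *v x)"
  by (simp add: outer_def inner_vec_def matrix_vector_mult_def sum_distrib_left ac_simps)

lemma vector_mult_sum_outer:
  "v v* (\<Sum>i\<in>I. c i *\<^sub>R outer (a i) (x i)) = (\<Sum>i\<in>I. (c i * (v \<bullet> a i)) *\<^sub>R x i)"
proof (induction I rule: infinite_finite_induct)
  case (insert i I)
  have "v v* (c i *\<^sub>R outer (a i) (x i)) = (c i * (v \<bullet> a i)) *\<^sub>R x i"
    by (simp add: vec_eq_iff vector_matrix_mult_def outer_def inner_vec_def sum_distrib_left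
        sum_distrib_right ac_simps)
  then show ?case
    using insert by (simp add: vector_matrix_mult_add_rdistrib)
qed auto

lemma continuous_on_outer:
  assumes "continuous_on S f" "continuous_on S g"
  shows "continuous_on S (\<lambda>s. outer (f s) (g s))"
  unfolding outer_def using assms by (intro continuous_intros)

section \<open>Contact pairs and diameter triples\<close>

lemma frontier_of_supporting:
  fixes a :: "'a::euclidean_space"
  assumes "x \<in> S" "a \<noteq> 0" "\<And>w. w \<in> S \<Longrightarrow> a \<bullet> w \<le> a \<bullet> x"
  shows "x \<in> frontier S"
proof -
  have "x \<notin> interior S"
  proof
    assume "x \<in> interior S"
    then obtain e where e: "e > 0" "cball x e \<subseteq> S" by (auto simp: mem_interior_cball)
    have "x + (e / norm a) *\<^sub>R a \<in> S"
      using e assms(2) by (intro subsetD[OF e(2)]) (auto simp: dist_norm)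
    then have "a \<bullet> (x + (e / norm a) *\<^sub>R a) \<le> a \<bullet> x" by (rule assms(3))
    moreover have "0 < e / norm a * (a \<bullet> a)"
      using e assms(2) by simp
    ultimately show False by (simp add: inner_add_right)
  qed
  then show ?thesis using assms(1) closure_subset by (auto simp: frontier_def)
qed

lemma compact_homothet:
  fixes L :: "'a::euclidean_space set"
  shows "compact L \<Longrightarrow> compact (homothet \<rho> c L)"
  unfolding homothet_def by (intro compact_continuous_image continuous_intros)

lemma interior_homothet:
  fixes L :: "'a::euclidean_space set"
  assumes "0 \<in> interior L" "\<rho> > 0"
  shows "c \<in> interior (homothet \<rho> c L)"
proof -
  obtain e where e: "e > 0" "cball 0 e \<subseteq> L" using assms(1) by (auto simp: mem_interior_cball)
  have "cball c (\<rho> * e) \<subseteq> homothet \<rho> c L"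
  proof
    fix x assume "x \<in> cball c (\<rho> * e)"
    then have "norm (x - c) \<le> \<rho> * e" by (simp add: dist_norm norm_minus_commute)
    then have "inverse \<rho> * norm (x - c) \<le> e" using assms(2) by (simp add: field_simps)
    then have "(x - c) /\<^sub>R \<rho> \<in> L"
      using assms(2) by (intro subsetD[OF e(2)]) simp
    then have "\<rho> *\<^sub>R ((x - c) /\<^sub>R \<rho>) + c \<in> homothet \<rho> c L" unfolding homothet_def by blast
    then show "x \<in> homothet \<rho> c L" using assms(2) by simp
  qed
  moreover have "\<rho> * e > 0" using e assms(2) by simp
  ultimately show ?thesis unfolding mem_interior_cball by blast
qed

lemma support_center_less:
  fixes a :: "'a::euclidean_space"
  assumes "c \<in> interior K" "a \<noteq> 0" "\<And>w. w \<in> K \<Longrightarrow> a \<bullet> w \<le> a \<bullet> x"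
  shows "a \<bullet> c < a \<bullet> x"
proof (rule ccontr)
  assume "\<not> a \<bullet> c < a \<bullet> x"
  then have "\<And>w. w \<in> K \<Longrightarrow> a \<bullet> w \<le> a \<bullet> c" using assms(3) by force
  then have "c \<in> frontier K"
    using assms(1,2) interior_subset by (intro frontier_of_supporting[of c K a]) auto
  then show False using assms(1) by (simp add: frontier_def)
qed

text \<open>In this form the diameter triples are visibly a closed subset of \<open>K \<times> K \<times> polar L\<close>.\<close>

lemma diameter_triple_iff:
  fixes K L :: "'a::euclidean_space set"
  assumes L: "compact L" "convex L" "0 \<in> interior L" and K: "compact K" "K \<noteq> {}"
  shows "diameter_triple K L y z b \<longleftrightarrow>
    y \<in> K \<and> z \<in> K \<and> b \<in> polar L \<and> rel_diameter K L \<le> (y - z) \<bullet> b"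
  using inner_le_gauge_fun[OF L, of b "y - z"] gauge_le_rel_diameter[OF L K, of y z]
  unfolding diameter_triple_def by auto

lemma diameter_triple_swap:
  fixes K L :: "'a::euclidean_space set"
  assumes "origin_symmetric L" "0 \<in> interior L" "compact L" "convex L" "compact K" "K \<noteq> {}"
    and "diameter_triple K L y z b"
  shows "diameter_triple K L z y (- b)"
  using assms(7) polar_uminus[OF assms(1)]
  unfolding diameter_triple_iff[OF assms(3,4,2,5,6)] by (simp add: inner_diff_left)

section \<open>Necessity\<close>

text \<open>The separating functional has a third component \<open>v\<close>, which gives only
  \<open>b \<bullet> A (y - z) < v \<bullet> b\<close>. Applying this to the swapped triple \<open>(z, y, - b)\<close> as well
  leaves the left-hand side unchanged and reverses the sign of the right-hand side.\<close>

lemma decomposition_or_improving_direction: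
  fixes K L :: "(real^'n) set"
  assumes K: "convex_body K" and L: "convex_body L" "origin_symmetric L"
    and c: "homothet (rel_inradius K L) c L \<subseteq> K"
    and no_dec: "\<not> contact_diameter_decomposition K L c"
  obtains A :: "real^'n^'n" and u
  where "\<And>p a. p \<in> homothet (rel_inradius K L) c L \<Longrightarrow> a \<noteq> 0 \<Longrightarrow> \<forall>w\<in>K. a \<bullet> w \<le> a \<bullet> p
           \<Longrightarrow> 0 < a \<bullet> (A *v p + u)"
    and "\<And>y z b. diameter_triple K L y z b \<Longrightarrow> b \<bullet> (A *v (y - z)) < 0"
proof -
  define C where "C = homothet (rel_inradius K L) c L"
  define D where "D = rel_diameter K L"
  have cL: "compact L" "convex L" and cK: "compact K" "convex K" "interior K \<noteq> {}"
    using K L by (auto simp: convex_body_def)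
  have L0: "0 \<in> interior L" using symmetric_convex_body_0_interior[OF L] .
  have neK: "K \<noteq> {}" using cK by auto
  have "D > 0" unfolding D_def by (rule rel_diameter_pos[OF cL L0 K])
  have "rel_inradius K L > 0"
    using rel_inradius_pos[OF compact_imp_bounded[OF cL(1)] L0 cK(1,3)] .
  then have "c \<in> interior K"
    using interior_homothet[OF L0] interior_mono[OF c] by blast
  define P where "P = {(x, a::real^'n). x \<in> C \<and> norm a = 1 \<and> (\<forall>w\<in>K. a \<bullet> w \<le> a \<bullet> x)}"
  define Q where "Q = {(y, z, b). diameter_triple K L y z b}"
  define f :: "(real^'n) \<times> (real^'n) \<Rightarrow> (real^'n^'n) \<times> (real^'n) \<times> (real^'n)"
    where "f = (\<lambda>q. (outer (snd q) (fst q), snd q, 0))"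
  define g :: "(real^'n) \<times> (real^'n) \<times> (real^'n) \<Rightarrow> (real^'n^'n) \<times> (real^'n) \<times> (real^'n)"
    where "g = (\<lambda>q. (- outer (snd (snd q)) (fst q - fst (snd q)), 0, snd (snd q)))"
  have "compact C" unfolding C_def by (rule compact_homothet[OF cL(1)])
  have "compact P"
  proof -
    have "P = (C \<times> sphere 0 1) \<inter> (\<Inter>w\<in>K. {q. snd q \<bullet> w \<le> snd q \<bullet> fst q})"
      by (auto simp: P_def)
    moreover have "closed (\<Inter>w\<in>K. {q::(real^'n) \<times> (real^'n). snd q \<bullet> w \<le> snd q \<bullet> fst q})"
      by (intro closed_INT ballI closed_Collect_le continuous_intros)
    ultimately show ?thesis
      using compact_Int_closed[OF compact_Times[OF \<open>compact C\<close> compact_sphere]] by simp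
  qed
  moreover have "continuous_on P f"
    unfolding f_def by (intro continuous_intros continuous_on_outer)
  ultimately have "compact (f ` P)" by (rule compact_continuous_image[rotated])
  have "compact Q"
  proof -
    have "Q = (K \<times> K \<times> polar L) \<inter> {q. D \<le> (fst q - fst (snd q)) \<bullet> snd (snd q)}"
      by (auto simp: Q_def D_def diameter_triple_iff[OF cL L0 cK(1) neK])
    moreover have "closed {q::(real^'n) \<times> (real^'n) \<times> (real^'n). D \<le> (fst q - fst (snd q)) \<bullet> snd (snd q)}"
      by (intro closed_Collect_le continuous_intros)
    ultimately show ?thesis
      using compact_Int_closed[OF compact_Times[OF cK(1) compact_Times[OF cK(1) compact_polar[OF L0]]]]
      by simp
  qed
  moreover have "continuous_on Q g"
    unfolding g_def by (intro continuous_intros continuous_on_outer)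
  ultimately have "compact (g ` Q)" by (rule compact_continuous_image[rotated])
  have "0 \<notin> convex hull (f ` P \<union> g ` Q)"
  proof
    assume "0 \<in> convex hull (f ` P \<union> g ` Q)"
    then obtain N M :: nat and p q lam \<mu> where NM: "1 \<le> N + M"
      and pP: "\<forall>i\<in>{1..N}. p i \<in> P \<and> 0 < lam i"
      and qQ: "\<forall>j\<in>{1..M}. q j \<in> Q \<and> 0 < \<mu> j"
      and eq: "(\<Sum>i=1..N. lam i *\<^sub>R f (p i)) + (\<Sum>j=1..M. \<mu> j *\<^sub>R g (q j)) = 0"
      by (rule conic_combination_of_images)
    have p: "p i \<in> P \<and> 0 < lam i" if "i \<in> {1..N}" for i using pP that by blast
    have q: "q j \<in> Q \<and> 0 < \<mu> j" if "j \<in> {1..M}" for j using qQ that by blast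
    define x a where "x i = fst (p i)" and "a i = snd (p i)" for i
    define y z b where "y j = fst (q j)" and "z j = fst (snd (q j))" and "b j = snd (snd (q j))" for j
    have xa: "x i \<in> C" "a i \<noteq> 0" "\<And>w. w \<in> K \<Longrightarrow> a i \<bullet> w \<le> a i \<bullet> x i" if "i \<in> {1..N}" for i
      using p[OF that] by (auto simp: P_def x_def a_def)
    have yzb: "diameter_triple K L (y j) (z j) (b j)" if "j \<in> {1..M}" for j
      using q[OF that] by (auto simp: Q_def y_def z_def b_def)
    have "(\<Sum>i=1..N. lam i *\<^sub>R outer (a i) (x i)) - (\<Sum>j=1..M. \<mu> j *\<^sub>R outer (b j) (y j - z j)) = 0"
      using arg_cong[OF eq, of fst]
      by (simp add: f_def g_def fst_sum x_def a_def y_def z_def b_def sum_negf)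
    then have outer_eq: "(\<Sum>i=1..N. lam i *\<^sub>R outer (a i) (x i)) = (\<Sum>j=1..M. \<mu> j *\<^sub>R outer (b j) (y j - z j))"
      by simp
    have a0: "(\<Sum>i=1..N. lam i *\<^sub>R a i) = 0"
      using arg_cong[OF eq, of "\<lambda>v. fst (snd v)"]
      by (simp add: f_def g_def fst_sum snd_sum a_def)
    have b0: "(\<Sum>j=1..M. \<mu> j *\<^sub>R b j) = 0"
      using arg_cong[OF eq, of "\<lambda>v. snd (snd v)"]
      by (simp add: f_def g_def fst_sum snd_sum b_def)
    \<comment> \<open>The trace of the matrix identity, recentred at \<open>c\<close>: its two sides are sums of positive
      terms, so neither can be empty.\<close>
    have "(\<Sum>i=1..N. lam i * (a i \<bullet> x i)) = (\<Sum>j=1..M. \<mu> j * (b j \<bullet> (y j - z j)))"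
      using arg_cong[OF outer_eq, of "\<lambda>B. mat 1 \<bullet> B"] by (simp add: inner_sum_right inner_outer)
    moreover have "(\<Sum>i=1..N. lam i * (a i \<bullet> c)) = 0"
      using arg_cong[OF a0, of "\<lambda>v. v \<bullet> c"] by (simp add: inner_sum_left)
    moreover have "b j \<bullet> (y j - z j) = D" if "j \<in> {1..M}" for j
      using yzb[OF that] by (simp add: diameter_triple_def D_def inner_commute)
    ultimately have trace: "(\<Sum>i=1..N. lam i * (a i \<bullet> x i - a i \<bullet> c)) = (\<Sum>j=1..M. \<mu> j * D)"
      by (simp add: right_diff_distrib sum_subtractf)
    have pos: "0 < lam i * (a i \<bullet> x i - a i \<bullet> c)" if "i \<in> {1..N}" for i
      using p[OF that] support_center_less[OF \<open>c \<in> interior K\<close> xa(2,3)[OF that]] by simp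
    have "1 \<le> N"
    proof (rule ccontr)
      assume "\<not> 1 \<le> N"
      then have "0 < (\<Sum>j=1..M. \<mu> j * D)"
        using NM q \<open>D > 0\<close> by (intro sum_pos) auto
      then show False using trace \<open>\<not> 1 \<le> N\<close> by simp
    qed
    have "1 \<le> M"
    proof (rule ccontr)
      assume "\<not> 1 \<le> M"
      have "0 < (\<Sum>i=1..N. lam i * (a i \<bullet> x i - a i \<bullet> c))"
        using \<open>1 \<le> N\<close> pos by (intro sum_pos) auto
      then show False using trace \<open>\<not> 1 \<le> M\<close> by simp
    qed
    have cp: "contact_pair (homothet (rel_inradius K L) c L) K (x i) (a i)" if "i \<in> {1..N}" for i
      using xa[OF that] c frontier_of_supporting[of "x i" K "a i"] frontier_of_supporting[of "x i" C "a i"]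
      by (auto simp: contact_pair_def C_def)
    have id: "(\<Sum>i=1..N. (lam i * (v \<bullet> a i)) *\<^sub>R x i)
        = (\<Sum>j=1..M. (\<mu> j * (v \<bullet> b j)) *\<^sub>R (y j - z j))" for v
      using arg_cong[OF outer_eq, of "\<lambda>B. v v* B"] by (simp add: vector_mult_sum_outer)
    have "contact_diameter_decomposition K L c"
      unfolding contact_diameter_decomposition_def
    proof (rule exI[of _ N], rule exI[of _ M], rule exI[of _ x], rule exI[of _ a], rule exI[of _ y],
        rule exI[of _ z], rule exI[of _ b], rule exI[of _ lam], rule exI[of _ \<mu>], intro conjI ballI allI)
      show "0 < lam i" if "i \<in> {1..N}" for i using p[OF that] by simp
      show "0 < \<mu> j" if "j \<in> {1..M}" for j using q[OF that] by simp
    qed (fact \<open>1 \<le> N\<close> \<open>1 \<le> M\<close> a0 b0 id | rule cp yzb, assumption)+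
    then show False using no_dec by blast
  qed
  moreover have "closed (convex hull (f ` P \<union> g ` Q))"
    using \<open>compact (f ` P)\<close> \<open>compact (g ` Q)\<close>
    by (intro compact_imp_closed compact_convex_hull compact_Un)
  ultimately obtain U \<beta> where "0 < \<beta>" "\<forall>v\<in>convex hull (f ` P \<union> g ` Q). U \<bullet> v > \<beta>"
    using separating_hyperplane_closed_0[OF convex_convex_hull] by blast
  then have sepf: "0 < U \<bullet> f s" if "s \<in> P" for s
    using that hull_inc[of "f s" "f ` P \<union> g ` Q" convex] by force
  have sepg: "0 < U \<bullet> g s" if "s \<in> Q" for s
    using \<open>0 < \<beta>\<close> \<open>\<forall>v\<in>convex hull (f ` P \<union> g ` Q). U \<bullet> v > \<beta>\<close> that
      hull_inc[of "g s" "f ` P \<union> g ` Q" convex] by force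
  obtain A u v where [simp]: "U = (A, u, v)" by (cases U)
  show ?thesis
  proof (rule that[of A u])
    fix p a assume pa: "p \<in> homothet (rel_inradius K L) c L" "a \<noteq> 0" "\<forall>w\<in>K. a \<bullet> w \<le> a \<bullet> p"
    \<comment> \<open>\<open>P\<close> contains only unit normals, which makes it compact; the conclusion is homogeneous in \<open>a\<close>.\<close>
    define a1 where "a1 = a /\<^sub>R norm a"
    have "(p, a1) \<in> P"
      using pa by (auto simp: P_def C_def a1_def intro: mult_left_mono)
    then have "0 < a1 \<bullet> (A *v p + u)"
      using sepf[of "(p, a1)"] by (simp add: f_def inner_outer inner_add_right inner_commute)
    then show "0 < a \<bullet> (A *v p + u)"
      using pa(2) by (simp add: a1_def zero_less_mult_iff)
  next
    fix y z b assume t: "diameter_triple K L y z b"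
    have 1: "b \<bullet> (A *v (y - z)) < v \<bullet> b"
      using sepg[of "(y, z, b)"] t by (simp add: g_def Q_def inner_outer)
    have "diameter_triple K L z y (- b)"
      using diameter_triple_swap[OF L(2) L0 cL cK(1) neK t] .
    then have "- b \<bullet> (A *v (z - y)) < v \<bullet> (- b)"
      using sepg[of "(z, y, - b)"] by (simp add: g_def Q_def inner_outer)
    moreover have "- b \<bullet> (A *v (z - y)) = b \<bullet> (A *v (y - z))"
      by (simp add: matrix_vector_mult_diff_distrib inner_diff_right)
    ultimately show "b \<bullet> (A *v (y - z)) < 0" using 1 by simp
  qed
qed

lemma minimal_ratio_imp_decomposition:
  fixes K L :: "(real^'n) set"
  assumes K: "convex_body K" and L: "convex_body L" "origin_symmetric L"
    and min: "min_diameter_inradius_ratio K L"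
    and c: "homothet (rel_inradius K L) c L \<subseteq> K"
  shows "contact_diameter_decomposition K L c"
proof (rule ccontr)
  assume "\<not> contact_diameter_decomposition K L c"
  then obtain A :: "real^'n^'n" and u where
    contact: "\<And>p a. p \<in> homothet (rel_inradius K L) c L \<Longrightarrow> a \<noteq> 0 \<Longrightarrow> \<forall>w\<in>K. a \<bullet> w \<le> a \<bullet> p
           \<Longrightarrow> 0 < a \<bullet> (A *v p + u)"
    and diam: "\<And>y z b. diameter_triple K L y z b \<Longrightarrow> b \<bullet> (A *v (y - z)) < 0"
    using decomposition_or_improving_direction[OF K L c] by metis
  have cL: "compact L" "convex L" and cK: "compact K" "convex K" "interior K \<noteq> {}"
    using K L by (auto simp: convex_body_def)
  have L0: "0 \<in> interior L" using symmetric_convex_body_0_interior[OF L] .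
  have neK: "K \<noteq> {}" using cK by auto
  let ?f = "\<lambda>t x. x + t *\<^sub>R (A *v x)"
  obtain d1 where d1: "d1 > 0" "\<And>t. 0 < t \<Longrightarrow> t < d1 \<Longrightarrow> rel_diameter (?f t ` K) L < rel_diameter K L"
    using rel_diameter_decreases[OF cL L0 cK(1) neK matrix_vector_mul_linear diam] by blast
  obtain d2 where d2: "d2 > 0" "\<And>t. 0 < t \<Longrightarrow> t < d2 \<Longrightarrow>
      homothet (rel_inradius K L) c L \<subseteq> (\<lambda>x. x + t *\<^sub>R (A *v x + u)) ` K"
    using perturbation_keeps_subset[OF cK(1,2) compact_homothet[OF cL(1)] c matrix_vector_mul_linear contact]
    by blast
  obtain d3 where d3: "d3 > 0" "\<And>t. 0 < t \<Longrightarrow> t < d3 \<Longrightarrow> det (mat 1 + t *\<^sub>R A) \<noteq> 0"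
    using det_perturbed_identity_nz by blast
  define t where "t = min d1 (min d2 d3) / 2"
  have t: "0 < t" "t < d1" "t < d2" "t < d3" using d1(1) d2(1) d3(1) by (auto simp: t_def)
  let ?B = "mat 1 + t *\<^sub>R A"
  define K' where "K' = (*v) ?B ` K"
  have Bx: "?B *v x = ?f t x" for x
    by (simp add: matrix_vector_mult_add_rdistrib scaleR_matrix_vector_assoc[symmetric])
  have K': "convex_body K'"
    unfolding K'_def using K d3(2)[OF t(1,4)] by (rule convex_body_matrix_image)
  have less: "rel_diameter K' L < rel_diameter K L"
    using d1(2)[OF t(1,2)] by (simp add: K'_def Bx)
  have "0 < rel_diameter K' L" by (rule rel_diameter_pos[OF cL L0 K'])
  have "0 < rel_inradius K L"
    using rel_inradius_pos[OF compact_imp_bounded[OF cL(1)] L0 cK(1,3)] .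
  \<comment> \<open>The translation part \<open>t u\<close> of the perturbation only moves the inscribed copy of \<open>L\<close>.\<close>
  have "homothet (rel_inradius K L) (c - t *\<^sub>R u) L \<subseteq> K'"
  proof
    fix p assume "p \<in> homothet (rel_inradius K L) (c - t *\<^sub>R u) L"
    then have "p + t *\<^sub>R u \<in> homothet (rel_inradius K L) c L"
      by (auto simp: homothet_def)
    then obtain x where "x \<in> K" "p + t *\<^sub>R u = x + t *\<^sub>R (A *v x + u)"
      using d2(2)[OF t(1,3)] by blast
    then show "p \<in> K'" by (auto simp: K'_def Bx scaleR_add_right)
  qed
  then have "rel_inradius K L \<le> rel_inradius K' L"
    using rel_inradius_ge[OF compact_imp_bounded[OF cL(1)] L0] K' \<open>0 < rel_inradius K L\<close>
    by (simp add: convex_body_def)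
  then have "rel_diameter K' L / rel_inradius K' L \<le> rel_diameter K' L / rel_inradius K L"
    using \<open>0 < rel_diameter K' L\<close> \<open>0 < rel_inradius K L\<close> by (intro divide_left_mono) auto
  also have "\<dots> < rel_diameter K L / rel_inradius K L"
    using less \<open>0 < rel_inradius K L\<close> by (intro divide_strict_right_mono) auto
  also have "\<dots> \<le> rel_diameter K' L / rel_inradius K' L"
    using min d3(2)[OF t(1,4)] unfolding min_diameter_inradius_ratio_def is_minimum_def K'_def by blast
  finally show False by simp
qed

section \<open>Sufficiency for ellipsoids\<close>

text \<open>Write \<open>L\<close> as the image under \<open>T\<close> of a unit ball centred at \<open>w\<close>. Symmetry and injectivity of
  \<open>T\<close> identify the unit balls about \<open>w\<close> and \<open>- w\<close>, whence \<open>w = 0\<close>.\<close>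

lemma ellipsoid_centered:
  fixes L :: "(real^'n) set"
  assumes "ellipsoid L" "origin_symmetric L"
  obtains T R :: "real^'n^'n" where "T ** R = mat 1" "R ** T = mat 1" "L = (*v) T ` cball 0 1"
proof -
  obtain T :: "real^'n^'n" and c where T: "det T \<noteq> 0" "L = (\<lambda>x. T *v x + c) ` cball 0 1"
    using assms(1) by (auto simp: ellipsoid_def)
  obtain R where R: "T ** R = mat 1" "R ** T = mat 1"
    using T(1) by (auto simp: invertible_det_nz[symmetric] invertible_def)
  define w where "w = R *v c"
  have c: "c = T *v w" by (simp add: w_def matrix_vector_mul_assoc R)
  have "L = (*v) T ` (+) w ` cball 0 1"
    unfolding T(2) image_image by (simp add: c matrix_vector_right_distrib add.commute)
  then have L1: "L = (*v) T ` cball w 1" by simp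
  have "uminus ` L = (*v) T ` uminus ` cball w 1"
    unfolding L1 image_image by (simp add: linear_neg[OF matrix_vector_mul_linear])
  also have "uminus ` cball w 1 = cball (- w) 1"
  proof (intro set_eqI iffI)
    fix x assume "x \<in> cball (- w) 1"
    then have "- x \<in> cball w 1" by (simp add: dist_norm norm_minus_commute add.commute)
    then show "x \<in> uminus ` cball w 1" by (rule image_eqI[rotated]) simp
  qed (auto simp: dist_norm norm_minus_commute add.commute)
  finally have "(*v) T ` cball w 1 = (*v) T ` cball (- w) 1"
    using L1 assms(2) by (simp add: origin_symmetric_def)
  moreover have "inj ((*v) T)"
    using T(1) by (simp add: invertible_det_nz[symmetric] inj_matrix_vector_mult)
  ultimately have "cball w 1 = cball (- w) 1" by (simp add: inj_image_eq_iff)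
  then have "w = - w" by (simp add: cball_eq_cball_iff)
  then have "2 *\<^sub>R w = 0" unfolding scaleR_2 by (simp only: eq_neg_iff_add_eq_0)
  then have "w = 0" by simp
  then show ?thesis using that R L1 by blast
qed

lemma gauge_fun_ellipsoid:
  fixes T R :: "real^'n^'n"
  assumes "T ** R = mat 1" "R ** T = mat 1"
  shows "gauge_fun ((*v) T ` cball 0 1) x = norm (R *v x)"
  unfolding gauge_fun_def
proof (rule Least_equality, intro conjI)
  define e where "e = (R *v x) /\<^sub>R norm (R *v x)"
  have "R *v x = norm (R *v x) *\<^sub>R e"
    by (cases "R *v x = 0") (auto simp: e_def)
  then have "T *v (R *v x) = norm (R *v x) *\<^sub>R (T *v e)"
    by (metis matrix_vector_mult_scaleR)
  then have "x = norm (R *v x) *\<^sub>R (T *v e) + 0"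
    by (simp add: matrix_vector_mul_assoc assms)
  moreover have "e \<in> cball 0 1" by (cases "R *v x = 0") (auto simp: e_def)
  ultimately show "x \<in> homothet (norm (R *v x)) 0 ((*v) T ` cball 0 1)"
    unfolding homothet_def by blast
next
  fix \<rho> assume "0 \<le> \<rho> \<and> x \<in> homothet \<rho> 0 ((*v) T ` cball 0 1)"
  then obtain e where "0 \<le> \<rho>" "norm e \<le> 1" "x = \<rho> *\<^sub>R (T *v e)"
    by (auto simp: homothet_def)
  then have "R *v x = \<rho> *\<^sub>R e"
    by (simp add: matrix_vector_mult_scaleR matrix_vector_mul_assoc assms)
  then show "norm (R *v x) \<le> \<rho>"
    using \<open>0 \<le> \<rho>\<close> \<open>norm e \<le> 1\<close> by (simp add: mult_left_le)
qed simp

text \<open>For the unit ball, the equality case of the Cauchy-Schwarz inequality ties each normal to its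
  contact point and each dual vector to its diameter.\<close>

lemma Cauchy_Schwarz_equality:
  fixes u \<alpha> :: "'a::real_inner"
  assumes "norm u \<le> 1" "norm \<alpha> \<le> \<alpha> \<bullet> u"
  shows "\<alpha> = norm \<alpha> *\<^sub>R u" and "\<alpha> \<noteq> 0 \<Longrightarrow> norm u = 1"
proof -
  have "(norm (\<alpha> - t *\<^sub>R u))\<^sup>2 = (norm \<alpha>)\<^sup>2 - 2 * t * (\<alpha> \<bullet> u) + t\<^sup>2 * (norm u)\<^sup>2" for t
    unfolding power2_norm_eq_inner
    by (simp add: inner_diff_left inner_diff_right inner_commute[of u \<alpha>] power2_eq_square
        algebra_simps)
  then have "(norm (\<alpha> - norm \<alpha> *\<^sub>R u))\<^sup>2 = (norm \<alpha>)\<^sup>2 - 2 * norm \<alpha> * (\<alpha> \<bullet> u) + (norm \<alpha>)\<^sup>2 * (norm u)\<^sup>2"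
    by blast
  also have "\<dots> \<le> (norm \<alpha>)\<^sup>2 - 2 * norm \<alpha> * norm \<alpha> + (norm \<alpha>)\<^sup>2 * 1"
    using assms by (intro add_mono diff_mono mult_left_mono) (auto simp: power_le_one)
  also have "\<dots> = 0" by (simp add: power2_eq_square)
  finally show eq: "\<alpha> = norm \<alpha> *\<^sub>R u" by simp
  show "norm u = 1" if "\<alpha> \<noteq> 0"
    using arg_cong[OF eq, of norm] that by simp
qed

lemma trace_of_congruence:
  fixes p :: "'i \<Rightarrow> 'a::euclidean_space" and F :: "'a \<Rightarrow> 'a"
  assumes F: "linear F"
  shows "(\<Sum>k\<in>Basis. F (\<Sum>i\<in>I. (a i * (adjoint F k \<bullet> p i)) *\<^sub>R p i) \<bullet> k)
    = (\<Sum>i\<in>I. a i * (norm (F (p i)))\<^sup>2)"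
proof -
  have "(\<Sum>k\<in>Basis. F (\<Sum>i\<in>I. (a i * (adjoint F k \<bullet> p i)) *\<^sub>R p i) \<bullet> k)
      = (\<Sum>k\<in>Basis. \<Sum>i\<in>I. a i * ((F (p i) \<bullet> k) * (F (p i) \<bullet> k)))"
    by (simp add: linear_sum[OF F] linear_scale[OF F] inner_sum_left
        inner_commute[of "adjoint F _"] adjoint_works[OF F] mult.assoc)
  also have "\<dots> = (\<Sum>i\<in>I. a i * (\<Sum>k\<in>Basis. (F (p i) \<bullet> k) * (F (p i) \<bullet> k)))"
    by (subst sum.swap) (simp add: sum_distrib_left)
  finally show ?thesis
    by (simp add: euclidean_inner[symmetric] power2_norm_eq_inner)
qed

text \<open>Both sides of the hypothesis are the same operator \<open>B\<close>; the conclusion computes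
  the trace of \<open>F B F\<^sup>T\<close> from each of them.\<close>

lemma trace_of_quadratic_form:
  fixes p :: "'i \<Rightarrow> 'a::euclidean_space" and s :: "'j \<Rightarrow> 'a" and F :: "'a \<Rightarrow> 'a"
  assumes eq: "\<And>v. (\<Sum>i\<in>I. (a i * (v \<bullet> p i)) *\<^sub>R p i) = (\<Sum>j\<in>J. (b j * (v \<bullet> s j)) *\<^sub>R s j)"
    and F: "linear F"
  shows "(\<Sum>i\<in>I. a i * (norm (F (p i)))\<^sup>2) = (\<Sum>j\<in>J. b j * (norm (F (s j)))\<^sup>2)"
proof -
  show ?thesis using trace_of_congruence[OF F, where I=I and a=a and p=p]
      trace_of_congruence[OF F, where I=J and a=b and p=s] by (simp add: eq)
qed

text \<open>Jensen's inequality for the convex function \<open>1 / sqrt x\<close> at the values \<open>(s i)\<^sup>2\<close>: each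
  term \<open>1 / s i\<close> is bounded below by the tangent at \<open>x = s0\<^sup>2\<close>.\<close>

lemma sum_inverse_ge_of_mean_square:
  fixes w s :: "'i \<Rightarrow> real"
  assumes "\<And>i. i \<in> I \<Longrightarrow> 0 \<le> w i" "\<And>i. i \<in> I \<Longrightarrow> 0 < s i" "0 < s0"
    and "(\<Sum>i\<in>I. w i * (s i)\<^sup>2) \<le> (\<Sum>i\<in>I. w i) * s0\<^sup>2"
  shows "(\<Sum>i\<in>I. w i) / s0 \<le> (\<Sum>i\<in>I. w i / s i)"
proof -
  have tangent: "(3 * s0\<^sup>2 - t\<^sup>2) / (2 * s0 ^ 3) \<le> 1 / t" if "0 < t" for t
  proof -
    have "0 \<le> (t - s0)\<^sup>2 * (t + 2 * s0)" using that assms(3) by simp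
    then have "(3 * s0\<^sup>2 - t\<^sup>2) * t \<le> 2 * s0 ^ 3"
      by (simp add: power2_eq_square power3_eq_cube algebra_simps)
    then show ?thesis using that assms(3) by (simp add: field_simps)
  qed
  have "(\<Sum>i\<in>I. w i) / s0 = (3 * s0\<^sup>2 * (\<Sum>i\<in>I. w i) - (\<Sum>i\<in>I. w i) * s0\<^sup>2) / (2 * s0 ^ 3)"
    using assms(3) by (simp add: field_simps power2_eq_square power3_eq_cube)
  also have "\<dots> \<le> (3 * s0\<^sup>2 * (\<Sum>i\<in>I. w i) - (\<Sum>i\<in>I. w i * (s i)\<^sup>2)) / (2 * s0 ^ 3)"
    using assms(3,4) by (intro divide_right_mono) auto
  also have "\<dots> = (\<Sum>i\<in>I. w i * ((3 * s0\<^sup>2 - (s i)\<^sup>2) / (2 * s0 ^ 3)))"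
  proof -
    have "3 * s0\<^sup>2 * (\<Sum>i\<in>I. w i) - (\<Sum>i\<in>I. w i * (s i)\<^sup>2) = (\<Sum>i\<in>I. w i * (3 * s0\<^sup>2 - (s i)\<^sup>2))"
      by (simp add: sum_distrib_right right_diff_distrib sum_subtractf ac_simps)
    then show ?thesis by (simp add: sum_divide_distrib)
  qed
  also have "\<dots> \<le> (\<Sum>i\<in>I. w i * (1 / s i))"
    using assms(1,2) tangent by (intro sum_mono mult_left_mono) auto
  finally show ?thesis by simp
qed

text \<open>The coordinates are \<open>R v\<close> for points and \<open>a v* T\<close> for normals; \<open>S = R A T\<close> is the matrix \<open>A\<close> in
  these coordinates.\<close>

lemma decomposition_imp_ratio_le:
  fixes K L :: "(real^'n) set" and A T R :: "real^'n^'n"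
  assumes K: "convex_body K" and L: "convex_body L" "origin_symmetric L"
    and TR: "T ** R = mat 1" "R ** T = mat 1" and LT: "L = (*v) T ` cball 0 1"
    and dec: "contact_diameter_decomposition K L c"
    and c: "homothet (rel_inradius K L) c L \<subseteq> K"
    and A: "det A \<noteq> 0"
  shows "rel_diameter K L / rel_inradius K L \<le> rel_diameter ((*v) A ` K) L / rel_inradius ((*v) A ` K) L"
proof -
  define K' where "K' = (*v) A ` K"
  define D r D' r' where "D = rel_diameter K L" and "r = rel_inradius K L"
    and "D' = rel_diameter K' L" and "r' = rel_inradius K' L"
  have K': "convex_body K'" unfolding K'_def using K A by (rule convex_body_matrix_image)
  have cL: "compact L" "convex L" and cK: "compact K" "K \<noteq> {}" "interior K \<noteq> {}"
    and cK': "compact K'" "K' \<noteq> {}" "interior K' \<noteq> {}"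
    using K K' L by (auto simp: convex_body_def)
  have L0: "0 \<in> interior L" using symmetric_convex_body_0_interior[OF L] .
  have pos: "0 < D" "0 < D'" "0 < r" "0 < r'"
    unfolding D_def D'_def r_def r'_def
    using rel_diameter_pos[OF cL L0 K] rel_diameter_pos[OF cL L0 K']
      rel_inradius_pos[OF compact_imp_bounded[OF cL(1)] L0 cK(1,3)]
      rel_inradius_pos[OF compact_imp_bounded[OF cL(1)] L0 cK'(1,3)] by auto
  have TRx: "T *v (R *v x) = x" "R *v (T *v x) = x" for x
    by (simp_all add: matrix_vector_mul_assoc TR)
  obtain B where "A ** B = mat 1" "B ** A = mat 1"
    using A by (auto simp: invertible_det_nz[symmetric] invertible_def)
  then have ABx: "A *v (B *v x) = x" "B *v (A *v x) = x" for x
    by (simp_all add: matrix_vector_mul_assoc)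
  define S where "S x = R *v (A *v (T *v x))" for x
  have linS: "linear S"
    unfolding S_def by (intro linearI) (simp_all add: matrix_vector_right_distrib matrix_vector_mult_scaleR)
  have S0: "x = 0" if "S x = 0" for x
  proof -
    have "T *v x = B *v (T *v S x)" by (simp add: S_def TRx ABx)
    then show ?thesis using that TRx(2)[of x] by simp
  qed
  have gauge: "gauge_fun L x = norm (R *v x)" for x
    unfolding LT using TR by (rule gauge_fun_ellipsoid)
  obtain N M :: nat and x a y z b lam \<mu> where
    N: "1 \<le> N" and
    xa: "\<forall>i\<in>{1..N}. contact_pair (homothet r c L) K (x i) (a i)" and
    yzb: "\<forall>j\<in>{1..M}. diameter_triple K L (y j) (z j) (b j)" and
    lam: "\<forall>i\<in>{1..N}. 0 < lam i" and \<mu>: "\<forall>j\<in>{1..M}. 0 < \<mu> j" and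
    id: "\<forall>v. (\<Sum>i=1..N. (lam i * (v \<bullet> a i)) *\<^sub>R x i) = (\<Sum>j=1..M. (\<mu> j * (v \<bullet> b j)) *\<^sub>R (y j - z j))" and
    a0: "(\<Sum>i=1..N. lam i *\<^sub>R a i) = 0"
    using dec unfolding contact_diameter_decomposition_def r_def by blast
  define \<alpha> u where "\<alpha> i = a i v* T" and "u i = (R *v (x i - c)) /\<^sub>R r" for i
  define \<beta> where "\<beta> j = b j v* T" for j
  have contact: "x i = r *\<^sub>R (T *v u i) + c \<and> norm (u i) = 1 \<and> \<alpha> i \<noteq> 0 \<and> \<alpha> i = norm (\<alpha> i) *\<^sub>R u i
      \<and> (\<forall>w\<in>K. a i \<bullet> w \<le> a i \<bullet> x i)" if i: "i \<in> {1..N}" for i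
  proof -
    have cp: "x i \<in> frontier (homothet r c L)" "x i \<in> frontier K" "a i \<noteq> 0" "\<forall>w\<in>K. a i \<bullet> w \<le> a i \<bullet> x i"
      using xa i by (auto simp: contact_pair_def)
    have "x i \<in> homothet r c L"
      using cp(1) frontier_subset_compact[OF compact_homothet[OF cL(1)]] by blast
    then obtain e where e: "norm e \<le> 1" "x i = r *\<^sub>R (T *v e) + c"
      by (auto simp: homothet_def LT)
    then have ui: "u i = e"
      using pos(3) by (simp add: u_def matrix_vector_mult_scaleR TRx)
    have "\<alpha> i \<noteq> 0"
    proof
      assume "\<alpha> i = 0"
      then have "a i v* (T ** R) = 0"
        by (simp add: vector_matrix_mul_assoc[symmetric] \<alpha>_def)
      then show False using cp(3) TR(1) by simp
    qed
    have "norm (\<alpha> i) \<le> \<alpha> i \<bullet> e"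
    proof -
      define e' where "e' = \<alpha> i /\<^sub>R norm (\<alpha> i)"
      have "norm e' \<le> 1" using \<open>\<alpha> i \<noteq> 0\<close> by (simp add: e'_def)
      then have "r *\<^sub>R (T *v e') + c \<in> homothet r c L"
        unfolding homothet_def LT by force
      then have "r *\<^sub>R (T *v e') + c \<in> K" using c by (auto simp: r_def)
      then have "a i \<bullet> (r *\<^sub>R (T *v e') + c) \<le> a i \<bullet> x i" using cp(4) by blast
      then have "\<alpha> i \<bullet> e' \<le> \<alpha> i \<bullet> e"
        using pos(3) by (simp add: e(2) inner_add_right \<alpha>_def dot_lmul_matrix)
      moreover have "\<alpha> i \<bullet> e' = norm (\<alpha> i)"
        using \<open>\<alpha> i \<noteq> 0\<close> by (simp add: e'_def power2_norm_eq_inner[symmetric] power2_eq_square)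
      ultimately show ?thesis by simp
    qed
    then show ?thesis
      using Cauchy_Schwarz_equality[OF e(1), of "\<alpha> i"] \<open>\<alpha> i \<noteq> 0\<close> e(2) ui cp(4) by simp
  qed
  have triple: "R *v (y j - z j) = D *\<^sub>R \<beta> j \<and> norm (S (D *\<^sub>R \<beta> j)) \<le> D' \<and> norm (\<beta> j) = 1"
    if j: "j \<in> {1..M}" for j
  proof -
    define \<eta> where "\<eta> = R *v (y j - z j)"
    have t: "y j \<in> K" "z j \<in> K" "b j \<in> polar L" "(y j - z j) \<bullet> b j = D" "norm \<eta> = D"
      using yzb j by (auto simp: diameter_triple_def D_def gauge \<eta>_def)
    have "norm (\<beta> j) \<le> 1"
    proof (cases "\<beta> j = 0")
      case False
      define e where "e = \<beta> j /\<^sub>R norm (\<beta> j)"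
      have "norm e \<le> 1" using False by (simp add: e_def)
      then have "T *v e \<in> L" unfolding LT by simp
      then have "(T *v e) \<bullet> b j \<le> 1" using t(3) by (auto simp: polar_def)
      then have "\<beta> j \<bullet> e \<le> 1" by (simp add: \<beta>_def dot_lmul_matrix inner_commute[of _ "b j"])
      then show ?thesis
        using False by (simp add: e_def power2_norm_eq_inner[symmetric] power2_eq_square field_simps)
    qed simp
    moreover have "norm \<eta> \<le> \<eta> \<bullet> \<beta> j"
    proof -
      have "\<eta> \<bullet> \<beta> j = b j \<bullet> (T *v \<eta>)" by (metis \<beta>_def dot_lmul_matrix inner_commute)
      then show ?thesis using t(4,5) by (simp add: \<eta>_def TRx inner_commute)
    qed
    ultimately have \<eta>: "\<eta> = D *\<^sub>R \<beta> j" "norm (\<beta> j) = 1"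
      using Cauchy_Schwarz_equality[of "\<beta> j" \<eta>] t(5) pos(1) by force+
    have "norm (S \<eta>) = gauge_fun L (A *v y j - A *v z j)"
      by (simp add: S_def \<eta>_def TRx gauge matrix_vector_mult_diff_distrib)
    also have "\<dots> \<le> D'"
      unfolding D'_def K'_def using t(1,2) cK'(1,2)
      by (intro gauge_le_rel_diameter[OF cL L0]) (auto simp: K'_def)
    finally show ?thesis using \<eta> by (simp add: \<eta>_def)
  qed
  define w where "w i = lam i * norm (\<alpha> i)" for i
  have w: "0 < w i" if "i \<in> {1..N}" for i
    using lam contact[OF that] that by (simp add: w_def)
  have form: "(\<Sum>i=1..N. (r * w i * (v \<bullet> u i)) *\<^sub>R u i) = (\<Sum>j=1..M. (D * \<mu> j * (v \<bullet> \<beta> j)) *\<^sub>R \<beta> j)" for v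
  proof -
    have va: "(T *v v) \<bullet> q = v \<bullet> (q v* T)" for q by (metis dot_lmul_matrix inner_commute)
    have "(\<Sum>i=1..N. lam i * (v \<bullet> \<alpha> i)) = (T *v v) \<bullet> (\<Sum>i=1..N. lam i *\<^sub>R a i)"
      by (simp add: inner_sum_right va \<alpha>_def)
    then have z: "(\<Sum>i=1..N. lam i * (v \<bullet> \<alpha> i)) = 0" using a0 by simp
    have "(\<Sum>i=1..N. (r * w i * (v \<bullet> u i)) *\<^sub>R u i)
        = (\<Sum>i=1..N. (lam i * (v \<bullet> \<alpha> i)) *\<^sub>R (R *v x i) - (lam i * (v \<bullet> \<alpha> i)) *\<^sub>R (R *v c))"
    proof (rule sum.cong[OF refl])
      fix i assume i: "i \<in> {1..N}"
      have "R *v x i - R *v c = r *\<^sub>R u i"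
        using pos(3) by (simp add: u_def matrix_vector_mult_diff_distrib)
      moreover have "v \<bullet> \<alpha> i = norm (\<alpha> i) * (v \<bullet> u i)"
        using contact[OF i] by (metis inner_scaleR_right)
      ultimately show "(r * w i * (v \<bullet> u i)) *\<^sub>R u i
          = (lam i * (v \<bullet> \<alpha> i)) *\<^sub>R (R *v x i) - (lam i * (v \<bullet> \<alpha> i)) *\<^sub>R (R *v c)"
        by (simp add: scaleR_diff_right[symmetric] w_def ac_simps)
    qed
    also have "\<dots> = (\<Sum>i=1..N. (lam i * (v \<bullet> \<alpha> i)) *\<^sub>R (R *v x i))"
      using z by (simp add: sum_subtractf scaleR_sum_left[symmetric])
    also have "\<dots> = R *v (\<Sum>i=1..N. (lam i * ((T *v v) \<bullet> a i)) *\<^sub>R x i)"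
      by (simp add: linear_sum[OF matrix_vector_mul_linear] matrix_vector_mult_scaleR va \<alpha>_def)
    also have "\<dots> = R *v (\<Sum>j=1..M. (\<mu> j * ((T *v v) \<bullet> b j)) *\<^sub>R (y j - z j))"
      using id by simp
    also have "\<dots> = (\<Sum>j=1..M. (\<mu> j * (v \<bullet> \<beta> j)) *\<^sub>R (R *v (y j - z j)))"
      by (simp add: linear_sum[OF matrix_vector_mul_linear] matrix_vector_mult_scaleR va \<beta>_def)
    also have "\<dots> = (\<Sum>j=1..M. (D * \<mu> j * (v \<bullet> \<beta> j)) *\<^sub>R \<beta> j)"
      using triple by (intro sum.cong) (auto simp: ac_simps)
    finally show ?thesis .
  qed
  define l m where "l = (\<Sum>i=1..N. w i)" and "m = (\<Sum>j=1..M. \<mu> j)"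
  have "0 < l" unfolding l_def using N w by (intro sum_pos) auto
  have "(\<Sum>i=1..N. r * w i * (norm (u i))\<^sup>2) = (\<Sum>j=1..M. D * \<mu> j * (norm (\<beta> j))\<^sup>2)"
    using trace_of_quadratic_form[OF form linear_ident] by simp
  then have rl: "r * l = D * m"
    using contact triple by (simp add: l_def m_def sum_distrib_left)
  have "r * (\<Sum>i=1..N. w i * (norm (S (u i)))\<^sup>2) = (\<Sum>j=1..M. D * \<mu> j * (norm (S (\<beta> j)))\<^sup>2)"
    using trace_of_quadratic_form[OF form linS] by (simp add: sum_distrib_left mult.assoc)
  also have "\<dots> \<le> (\<Sum>j=1..M. D * \<mu> j * (D' / D)\<^sup>2)"
  proof (intro sum_mono mult_left_mono power_mono)
    fix j assume j: "j \<in> {1..M}"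
    have "D * norm (S (\<beta> j)) \<le> D'"
      using triple[OF j] pos(1) by (simp add: linear_scale[OF linS])
    then show "norm (S (\<beta> j)) \<le> D' / D" using pos(1) by (simp add: field_simps)
    show "0 \<le> D * \<mu> j" using \<mu> j pos(1) by (simp add: less_imp_le)
  qed simp
  also have "\<dots> = D * m * (D' / D)\<^sup>2"
    by (simp add: m_def sum_distrib_left sum_distrib_right)
  also have "\<dots> = r * (l * (D' / D)\<^sup>2)" using rl by simp
  finally have "(\<Sum>i=1..N. w i * (norm (S (u i)))\<^sup>2) \<le> l * (D' / D)\<^sup>2"
    using pos(3) by (simp add: mult_le_cancel_left)
  moreover have Su: "0 < norm (S (u i))" if "i \<in> {1..N}" for i
    using contact[OF that] S0[of "u i"] by force
  ultimately have lower: "l / (D' / D) \<le> (\<Sum>i=1..N. w i / norm (S (u i)))"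
    unfolding l_def using w pos by (intro sum_inverse_ge_of_mean_square) (auto simp: less_imp_le)
  obtain c' where c': "homothet r' c' L \<subseteq> K'"
    using rel_inradius_homothet[OF compact_imp_bounded[OF cL(1)] L0 cK'(1,3)] by (auto simp: r'_def)
  have "r' * (w i / norm (S (u i))) \<le> r * w i + lam i * (a i \<bullet> c) - lam i * (a i \<bullet> (B *v c'))"
    if i: "i \<in> {1..N}" for i
  proof -
    note ct = contact[OF i]
    \<comment> \<open>Among the points of the inscribed ellipsoid in \<open>A K\<close>, this direction is the one whose
      preimage under \<open>A\<close> is a multiple of \<open>T (u i)\<close>, on which the normal \<open>a i\<close> is known.\<close>
    define e where "e = S (u i) /\<^sub>R norm (S (u i))"
    have "norm e \<le> 1" using Su[OF i] by (simp add: e_def)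
    then have "r' *\<^sub>R (T *v e) + c' \<in> homothet r' c' L"
      unfolding homothet_def LT by force
    then obtain k where k: "k \<in> K" "r' *\<^sub>R (T *v e) + c' = A *v k" using c' by (auto simp: K'_def)
    have "B *v (T *v e) = (T *v u i) /\<^sub>R norm (S (u i))"
      by (simp add: e_def S_def matrix_vector_mult_scaleR TRx ABx)
    then have "k = (r' / norm (S (u i))) *\<^sub>R (T *v u i) + B *v c'"
      using arg_cong[OF k(2), of "(*v) B"]
      by (simp add: ABx matrix_vector_right_distrib matrix_vector_mult_scaleR divide_inverse)
    moreover have "a i \<bullet> (T *v u i) = norm (\<alpha> i)"
    proof -
      have "a i \<bullet> (T *v u i) = \<alpha> i \<bullet> u i" by (simp add: \<alpha>_def dot_lmul_matrix)
      also have "\<dots> = norm (\<alpha> i) * (u i \<bullet> u i)" using ct by (metis inner_scaleR_left)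
      also have "\<dots> = norm (\<alpha> i)" using ct by (simp add: power2_norm_eq_inner[symmetric])
      finally show ?thesis .
    qed
    moreover have "a i \<bullet> k \<le> a i \<bullet> (r *\<^sub>R (T *v u i) + c)"
      using ct k(1) by metis
    ultimately have "r' / norm (S (u i)) * norm (\<alpha> i) + a i \<bullet> (B *v c') \<le> r * norm (\<alpha> i) + a i \<bullet> c"
      by (simp add: inner_add_right)
    then have "lam i * (r' / norm (S (u i)) * norm (\<alpha> i) + a i \<bullet> (B *v c')) \<le> lam i * (r * norm (\<alpha> i) + a i \<bullet> c)"
      using lam i by (intro mult_left_mono) (auto simp: less_imp_le)
    then show ?thesis by (simp add: w_def algebra_simps)
  qed
  \<comment> \<open>In the sum, the unknown centres \<open>c\<close> and \<open>c'\<close> cancel because the weighted normals sum to zero.\<close>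
  then have "(\<Sum>i=1..N. r' * (w i / norm (S (u i))))
      \<le> (\<Sum>i=1..N. r * w i + lam i * (a i \<bullet> c) - lam i * (a i \<bullet> (B *v c')))"
    by (intro sum_mono) auto
  also have "\<dots> = r * l + (\<Sum>i=1..N. lam i *\<^sub>R a i) \<bullet> c - (\<Sum>i=1..N. lam i *\<^sub>R a i) \<bullet> (B *v c')"
    by (simp add: sum_subtractf sum.distrib l_def sum_distrib_left inner_sum_left)
  finally have upper: "r' * (\<Sum>i=1..N. w i / norm (S (u i))) \<le> r * l"
    using a0 by (simp add: sum_distrib_left)
  have "r' * (l / (D' / D)) \<le> r * l"
    using mult_left_mono[OF lower, of r'] upper pos(4) by linarith
  then have "(r' * D) * l \<le> (r * D') * l"
    using pos(2) by (simp add: field_simps)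
  then have "r' * D \<le> r * D'" using \<open>0 < l\<close> by simp
  then have "D / r \<le> D' / r'" using pos by (simp add: field_simps)
  then show ?thesis by (simp add: D_def r_def D'_def r'_def K'_def)
qed

theorem corollary3p4:
  fixes K L :: "(real^'n) set"
  assumes "convex_body K" and "convex_body L" and "origin_symmetric L"
  shows "(min_diameter_inradius_ratio K L \<longrightarrow>
            (\<forall>c. homothet (rel_inradius K L) c L \<subseteq> K \<longrightarrow> contact_diameter_decomposition K L c))
       \<and> (ellipsoid L \<longrightarrow>
            (\<forall>c. homothet (rel_inradius K L) c L \<subseteq> K \<longrightarrow> contact_diameter_decomposition K L c) \<longrightarrow>
            min_diameter_inradius_ratio K L)"
proof (intro conjI impI)
  show "\<forall>c. homothet (rel_inradius K L) c L \<subseteq> K \<longrightarrow> contact_diameter_decomposition K L c"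
    if "min_diameter_inradius_ratio K L"
    using minimal_ratio_imp_decomposition[OF assms that] by blast
next
  assume "ellipsoid L"
    and dec: "\<forall>c. homothet (rel_inradius K L) c L \<subseteq> K \<longrightarrow> contact_diameter_decomposition K L c"
  obtain T R :: "real^'n^'n" where TR: "T ** R = mat 1" "R ** T = mat 1" "L = (*v) T ` cball 0 1"
    using ellipsoid_centered[OF \<open>ellipsoid L\<close> assms(3)] .
  have "bounded L" "compact K" "interior K \<noteq> {}"
    using assms by (auto simp: convex_body_def compact_imp_bounded)
  then obtain c where c: "homothet (rel_inradius K L) c L \<subseteq> K"
    using rel_inradius_homothet symmetric_convex_body_0_interior[OF assms(2,3)] by blast
  have "rel_diameter K L / rel_inradius K L
      \<le> rel_diameter ((*v) A ` K) L / rel_inradius ((*v) A ` K) L" if "det A \<noteq> 0" for A :: "real^'n^'n"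
    using decomposition_imp_ratio_le[OF assms TR _ c that] dec c by blast
  moreover have "(*v) (mat 1) ` K = K" by simp
  moreover have "det (mat 1 :: real^'n^'n) \<noteq> 0" by simp
  ultimately show "min_diameter_inradius_ratio K L"
    unfolding min_diameter_inradius_ratio_def is_minimum_def
    by (intro conjI) (auto intro!: exI[of _ "mat 1"])
qed

end
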